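(* Let $F$ be a field, $m\ge1$, and let $P_1=X^{s_1}Q_1,\ldots,P_m=X^{s_m}Q_m$ be nonconstant monic polynomials over $F$, where $Q_i(0)\neq0$ for $1\le i\le m$. Then $$\prod_{i=1}^m L(P_i)=L\bigl(X^{\rho}\,\Upsilon(Q_1,\ldots,Q_m)\bigr),$$ where $\Theta=\{i : Q_i=1\}$ and $$\rho=\begin{cases}\min\{s_i : i\in\Theta\}&\text{if }\Theta\neq\emptyset,\\ \max\{s_i : 1\le i\le m\}&\text{otherwise.}\end{cases}$$
   Context: $\mathcal{C}_F$ is the set of all sequences $(s_n)_{n\ge0}$ over $F$. For a monic polynomial $P=X^d+c_{d-1}X^{d-1}+\cdots+c_0\in F[X]$, $L(P)$ is the $F$-vector space of all sequences $(s_n)_{n\ge0}$ over $F$ with $s_{n+d}+c_{d-1}s_{n+d-1}+\cdots+c_0s_n=0$ for all $n\ge0$ (so $L(1)=\{0\}$). For $F$-subspaces $H,H'$ of $\mathcal{C}_F$, the product $HH'$ is the subspace spanned by all componentwise (Hadamard) products $cd$, $c\in H$, $d\in H'$. The operation $\wedge$ on $\mathbb{N}=\{0,1,2,\dots\}$ (depending on the characteristic of $F$): for positive integers $i,j$, $i\wedge j$ is the maximum value of $r+s+1$ over integers $0\le r\le i-1$, $0\le s\le j-1$ with $\binom{r+s}{r}\ne0$ in $F$; and $0\wedge n=n\wedge0=0$ for all $n$. It is associative and commutative. Let $\overline{F}$ be an algebraic closure of $F$, and for $\lambda\in\overline{F}$ let $\lambda(Q)\in\mathbb{N}$ be the multiplicity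 of $\lambda$ as a root of $Q$ ($0$ if not a root). For monic polynomials $Q_1,\dots,Q_m$ over $F$ with $Q_i(0)\ne0$, $$\Upsilon(Q_1,\dots,Q_m)=\prod_{\gamma\in\overline{F}^{\ast}}(X-\gamma)^{e(\gamma)},\qquad e(\gamma)=\max\{\lambda_1(Q_1)\wedge\cdots\wedge\lambda_m(Q_m): (\lambda_1,\dots,\lambda_m)\in(\overline{F}^{\ast})^m,\ \lambda_1\cdots\lambda_m=\gamma\},$$ a product with only finitely many nontrivial factors; this polynomial has coefficients in $F$. *)

theory Defs
  imports
    "HOL-Library.Function_Algebras"
    "HOL-Computational_Algebra.Computational_Algebra"
    "HOL-Algebra.Algebraic_Closure_Type"
begin

text \<open>
  The space of all sequences over a field \<open>F\<close> is the type \<open>nat \<Rightarrow> 'a\<close> with \<open>'a :: field\<close>.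
  Its addition and its Hadamard product \<open>*\<close> are the pointwise operations of
  \<^theory>\<open>HOL-Library.Function_Algebras\<close>.
\<close>

definition seq_scale :: "'a::field \<Rightarrow> (nat \<Rightarrow> 'a) \<Rightarrow> (nat \<Rightarrow> 'a)" where
  "seq_scale a c = (\<lambda>n. a * c n)"

interpretation seq: vector_space "seq_scale :: 'a::field \<Rightarrow> (nat \<Rightarrow> 'a) \<Rightarrow> (nat \<Rightarrow> 'a)"
  by standard (simp_all add: seq_scale_def fun_eq_iff algebra_simps)

text \<open>
  The solution space \<open>L(P)\<close>; it is used for monic \<open>P\<close> only, where the summand for
  \<open>k = degree P\<close> is \<open>c (n + degree P)\<close>.
\<close>

definition lin_rec_space :: "'a::field poly \<Rightarrow> (nat \<Rightarrow> 'a) set" where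
  "lin_rec_space P = {c. \<forall>n. (\<Sum>k\<le>degree P. coeff P k * c (n + k)) = 0}"

definition seq_space_prod ::
    "(nat \<Rightarrow> 'a::field) set \<Rightarrow> (nat \<Rightarrow> 'a) set \<Rightarrow> (nat \<Rightarrow> 'a) set" where
  "seq_space_prod H H' = seq.span {c * d | c d. c \<in> H \<and> d \<in> H'}"

text \<open>
  \<open>g 1 \<star> g 2 \<star> \<dots> \<star> g m\<close> for a binary operation \<open>\<star>\<close> and \<open>m \<ge> 1\<close>, bracketed to the left;
  for \<open>m = 1\<close> this is \<open>g 1\<close>. The value for \<open>m = 0\<close> is irrelevant.
\<close>

definition iterated :: "('b \<Rightarrow> 'b \<Rightarrow> 'b) \<Rightarrow> nat \<Rightarrow> (nat \<Rightarrow> 'b) \<Rightarrow> 'b" where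
  "iterated f m g = foldl f (g 1) (map g [2..<Suc m])"

text \<open>
  The operation \<open>\<and>\<close> on natural numbers. It depends on the field through its characteristic,
  hence the type argument.
\<close>

definition wedge :: "'a::field itself \<Rightarrow> nat \<Rightarrow> nat \<Rightarrow> nat" where
  "wedge (F :: 'a itself) i j =
     (if i = 0 \<or> j = 0 then 0
      else Max {r + s + 1 | r s. r \<le> i - 1 \<and> s \<le> j - 1 \<and>
                                 (of_nat ((r + s) choose r) :: 'a) \<noteq> 0})"

text \<open>
  The exponent \<open>e(\<gamma>)\<close>, for \<open>\<gamma> \<noteq> 0\<close>. Tuples are functions of which only the values on
  \<open>{1..m}\<close> matter. The multiplicity \<^const>\<open>Polynomial.order\<close> is \<open>0\<close> at non-roots (of nonzero polynomials), and
  the set of values is finite, since multiplicities are bounded by degrees.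
\<close>

definition upsilon_exponent :: "nat \<Rightarrow> (nat \<Rightarrow> 'a::field poly) \<Rightarrow> 'a alg_closure \<Rightarrow> nat" where
  "upsilon_exponent m Q \<gamma> =
     Max {iterated (wedge TYPE('a)) m (\<lambda>i. Polynomial.order (\<Lambda> i) (map_poly to_ac (Q i))) | \<Lambda>.
            (\<forall>i\<in>{1..m}. \<Lambda> i \<noteq> 0) \<and> (\<Prod>i\<in>{1..m}. \<Lambda> i) = \<gamma>}"

text \<open>The product is restricted to its finitely many nontrivial factors.\<close>

definition upsilon_ac :: "nat \<Rightarrow> (nat \<Rightarrow> 'a::field poly) \<Rightarrow> 'a alg_closure poly" where
  "upsilon_ac m Q =
     (\<Prod>\<gamma> | \<gamma> \<noteq> 0 \<and> upsilon_exponent m Q \<gamma> \<noteq> 0. [:- \<gamma>, 1:] ^ upsilon_exponent m Q \<gamma>)"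

text \<open>
  \<open>\<Upsilon>\<close> as a polynomial over the base field: the unique polynomial whose image over the
  algebraic closure is the product above (unique because \<^const>\<open>to_ac\<close> is injective).
\<close>

definition upsilon :: "nat \<Rightarrow> (nat \<Rightarrow> 'a::field poly) \<Rightarrow> 'a poly" where
  "upsilon m Q = (THE R. map_poly to_ac R = upsilon_ac m Q)"

end

theory Submission
  imports Defs
begin

text \<open>
  The space \<open>L(P)\<close> is the kernel of \<open>P\<close> evaluated at the shift operator, so coprime factors of \<open>P\<close>
  give direct summands; in particular \<open>L(X^s Q) = L(X^s) + L(Q)\<close> when \<open>Q(0) \<noteq> 0\<close>. The first summand
  consists of the sequences supported on \<open>{0..<s}\<close>, and \<open>L(Q)\<close> is either \<open>0\<close> or contains, for each \<open>n\<close>,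
  a sequence that does not vanish at \<open>n\<close>; this yields the exponent \<open>\<rho>\<close>. Over the algebraic closure
  \<open>L(Q)\<close> is spanned by the sequences \<open>(n choose k) \<gamma>^n\<close> with \<open>k\<close> below the multiplicity of \<open>\<gamma>\<close>, and
  expanding \<open>(n choose i) (n choose j)\<close> in binomial coefficients \<open>n choose k\<close> produces the operation
  \<open>\<and>\<close> on multiplicities. Finally \<open>\<Upsilon>\<close> descends to \<open>F\<close> because it is determined by its solution space,
  which is the extension of scalars of a space of sequences over \<open>F\<close>.
\<close>

section \<open>The action of polynomials on sequences through the shift operator\<close>

definition poly_shift :: "'a::field poly \<Rightarrow> (nat \<Rightarrow> 'a) \<Rightarrow> (nat \<Rightarrow> 'a)" where
  "poly_shift P c = (\<lambda>n. \<Sum>k\<le>degree P. coeff P k * c (n + k))"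

lemma lin_rec_space_iff: "c \<in> lin_rec_space P \<longleftrightarrow> poly_shift P c = 0"
  by (auto simp: lin_rec_space_def poly_shift_def fun_eq_iff)

text \<open>A bound \<open>N\<close> that need not be sharp brings polynomials of different degrees
  under one range of summation.\<close>

lemma poly_shift_altdef:
  assumes "degree P \<le> N"
  shows "poly_shift P c n = (\<Sum>k\<le>N. coeff P k * c (n + k))"
  unfolding poly_shift_def using assms
  by (intro sum.mono_neutral_left) (auto simp: coeff_eq_0)

lemma poly_shift_0 [simp]: "poly_shift 0 c = 0"
  by (simp add: poly_shift_def fun_eq_iff)

lemma poly_shift_1 [simp]: "poly_shift 1 c = c"
  by (simp add: poly_shift_def fun_eq_iff)

lemma poly_shift_add: "poly_shift (P + Q) c = poly_shift P c + poly_shift Q c"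
proof
  fix n
  show "poly_shift (P + Q) c n = (poly_shift P c + poly_shift Q c) n"
    using degree_add_le_max[of P Q]
    by (simp add: poly_shift_altdef[where N = "max (degree P) (degree Q)"] sum.distrib algebra_simps)
qed

lemma poly_shift_smult: "poly_shift (smult a P) c = seq_scale a (poly_shift P c)"
proof
  fix n
  show "poly_shift (smult a P) c n = seq_scale a (poly_shift P c) n"
    by (simp add: poly_shift_altdef[where N = "degree P"] degree_smult_le seq_scale_def
        sum_distrib_left mult_ac)
qed

lemma poly_shift_pCons:
  "poly_shift (pCons a P) c n = a * c n + poly_shift P c (Suc n)"
proof -
  have "poly_shift (pCons a P) c n = (\<Sum>k\<le>Suc (degree P). coeff (pCons a P) k * c (n + k))"
    by (rule poly_shift_altdef) (rule degree_pCons_le)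
  also have "\<dots> = a * c n + poly_shift P c (Suc n)"
    by (subst sum.atMost_Suc_shift) (simp add: poly_shift_def)
  finally show ?thesis .
qed

lemma poly_shift_seq_add: "poly_shift P (c + d) = poly_shift P c + poly_shift P d"
  by (simp add: poly_shift_def fun_eq_iff algebra_simps sum.distrib)

lemma poly_shift_seq_scale: "poly_shift P (seq_scale a c) = seq_scale a (poly_shift P c)"
  by (simp add: poly_shift_def fun_eq_iff seq_scale_def sum_distrib_left mult_ac)

lemma poly_shift_seq_0 [simp]: "poly_shift P 0 = 0"
  by (simp add: poly_shift_def fun_eq_iff)

text \<open>Together with additivity this makes the sequences a module over the polynomial ring. The
  induction over the coefficients of \<open>P\<close> works because multiplication by X acts as an
  index shift.\<close>

lemma poly_shift_mult: "poly_shift (P * Q) c = poly_shift P (poly_shift Q c)"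
proof (induction P)
  case 0
  then show ?case by simp
next
  case (pCons a P)
  have "poly_shift (pCons a P * Q) c n = poly_shift (pCons a P) (poly_shift Q c) n" for n
    by (simp only: mult_pCons_left poly_shift_add poly_shift_smult poly_shift_pCons pCons.IH)
       (simp add: poly_shift_pCons pCons.IH seq_scale_def)
  then show ?case by blast
qed

lemma lin_rec_space_subspace: "seq.subspace (lin_rec_space P)"
  by (auto intro!: seq.subspaceI simp: lin_rec_space_iff poly_shift_seq_add poly_shift_seq_scale)

lemma lin_rec_space_1 [simp]: "lin_rec_space 1 = {0}"
  by (auto simp: lin_rec_space_iff)

lemma lin_rec_space_dvd:
  assumes "P dvd Q"
  shows "lin_rec_space P \<subseteq> lin_rec_space Q"
  using assms by (auto elim!: dvdE simp: lin_rec_space_iff mult.commute[of P] poly_shift_mult)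

lemma poly_shift_monom: "poly_shift (monom 1 k) c n = c (n + k)"
  by (subst poly_shift_altdef[where N = k]) (auto simp: degree_monom_le if_distrib sum.delta'
      if_distribR cong: if_cong)

section \<open>Coprime factors and sums of solution spaces\<close>

text \<open>With \<open>b = 1 / B(a)\<close> the polynomial \<open>1 - smult b B\<close> vanishes at
  \<open>a\<close>, which gives the identity for exponent 1. Its product with the identity for
  \<open>k\<close> is the one for \<open>Suc k\<close>: every term without the full power of X - a
  contains \<open>B\<close>.\<close>

lemma power_linear_bezout:
  fixes B :: "'a::field poly"
  assumes "poly B a \<noteq> 0"
  shows "\<exists>U V. [:-a, 1:] ^ k * U + B * V = 1"
proof (induction k)
  case 0
  show ?case by (rule exI[of _ 1], rule exI[of _ 0]) simp
next
  case (Suc k)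
  then obtain U V where UV: "[:-a, 1:] ^ k * U + B * V = 1" by blast
  define b where "b = inverse (poly B a)"
  have "poly (1 - smult b B) a = 0" using assms by (simp add: b_def)
  then obtain U' where U': "1 - smult b B = [:-a, 1:] * U'"
    by (metis poly_eq_0_iff_dvd dvdE)
  then have 1: "[:-a, 1:] * U' + B * [:b:] = 1" by (simp add: algebra_simps)
  have "1 = ([:-a, 1:] * U' + B * [:b:]) * ([:-a, 1:] ^ k * U + B * V)"
    unfolding 1 UV by simp
  also have "\<dots> = [:-a, 1:] ^ Suc k * (U' * U)
      + B * ([:b:] * ([:-a, 1:] ^ k * U) + [:-a, 1:] * U' * V + B * V * [:b:])"
    unfolding power_Suc by (simp only: algebra_simps)
  finally show ?case by metis
qed

text \<open>The Bezout identity splits \<open>c\<close> into its images under \<open>V * B\<close>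
  and \<open>U * A\<close>; if \<open>A * B\<close> kills \<open>c\<close>, then \<open>A\<close>
  kills the first and \<open>B\<close> the second.\<close>

lemma lin_rec_space_coprime:
  assumes "U * A + V * B = (1 :: 'a::field poly)"
  shows "c \<in> lin_rec_space (A * B) \<longleftrightarrow>
           (\<exists>a\<in>lin_rec_space A. \<exists>b\<in>lin_rec_space B. c = a + b)"
proof
  assume c: "c \<in> lin_rec_space (A * B)"
  have "c = poly_shift (V * B) c + poly_shift (U * A) c"
    by (metis assms poly_shift_1 poly_shift_add add.commute)
  moreover have "poly_shift (V * B) c \<in> lin_rec_space A" "poly_shift (U * A) c \<in> lin_rec_space B"
    using c poly_shift_mult[of V "A * B" c] poly_shift_mult[of U "A * B" c]
    by (simp_all add: lin_rec_space_iff mult_ac flip: poly_shift_mult)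
  ultimately show "\<exists>a\<in>lin_rec_space A. \<exists>b\<in>lin_rec_space B. c = a + b" by blast
next
  assume "\<exists>a\<in>lin_rec_space A. \<exists>b\<in>lin_rec_space B. c = a + b"
  then show "c \<in> lin_rec_space (A * B)"
    by (metis dvd_triv_left dvd_triv_right lin_rec_space_dvd lin_rec_space_subspace seq.subspace_add subsetD)
qed

section \<open>Solutions with prescribed initial values\<close>

text \<open>The test \<open>k < degree P\<close> inside the sum repeats the range so that
  termination is provable: it gives \<open>n - degree P + k < n\<close> when
  \<open>n \<ge> degree P\<close>.\<close>

fun rec_solution :: "'a::field poly \<Rightarrow> (nat \<Rightarrow> 'a) \<Rightarrow> nat \<Rightarrow> 'a" where
  "rec_solution P u n = (if n < degree P then u n
     else - (\<Sum>k<degree P. if k < degree P then coeff P k * rec_solution P u (n - degree P + k) else 0))"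

declare rec_solution.simps [simp del]

lemma rec_solution_init: "n < degree P \<Longrightarrow> rec_solution P u n = u n"
  by (subst rec_solution.simps) simp

lemma rec_solution_lin_rec:
  assumes "lead_coeff P = 1"
  shows "rec_solution P u \<in> lin_rec_space P"
proof -
  have "(\<Sum>k\<le>degree P. coeff P k * rec_solution P u (n + k)) = 0" for n
  proof -
    have "(\<Sum>k\<le>degree P. coeff P k * rec_solution P u (n + k)) =
      (\<Sum>k<degree P. coeff P k * rec_solution P u (n + k)) + rec_solution P u (n + degree P)"
      using assms by (simp add: lessThan_Suc_atMost[symmetric])
    also have "rec_solution P u (n + degree P) = - (\<Sum>k<degree P. coeff P k * rec_solution P u (n + k))"
      by (subst rec_solution.simps) simp
    finally show ?thesis by simp
  qed
  then show ?thesis by (simp add: lin_rec_space_def)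
qed

lemma lin_rec_space_init_eq:
  assumes "lead_coeff P = 1" "c \<in> lin_rec_space P" "d \<in> lin_rec_space P"
    and "\<And>n. n < degree P \<Longrightarrow> c n = d n"
  shows "c = d"
proof
  have rec: "x (n + degree P) = - (\<Sum>k<degree P. coeff P k * x (n + k))"
    if "x \<in> lin_rec_space P" for x n
  proof -
    have "(\<Sum>k<degree P. coeff P k * x (n + k)) + x (n + degree P) = 0"
      using that assms(1) by (simp add: lin_rec_space_def lessThan_Suc_atMost[symmetric])
    then show ?thesis by (simp add: add_eq_0_iff2)
  qed
  fix n
  show "c n = d n"
  proof (induction n rule: less_induct)
    case (less n)
    show ?case
    proof (cases "n < degree P")
      case False
      then obtain l where l: "n = l + degree P" by (metis le_Suc_ex not_less add.commute)
      show ?thesis unfolding l rec[OF assms(2)] rec[OF assms(3)]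
        using less l by (intro arg_cong[where f = uminus] sum.cong) auto
    qed (use assms in auto)
  qed
qed

text \<open>The solution of \<open>P\<close> whose initial values form the \<open>k\<close>-th unit
  vector satisfies both recurrences. At index 0 the leading terms agree, and what remains compares
  the \<open>k\<close>-th coefficients.\<close>

lemma lin_rec_space_same_degree:
  assumes "lead_coeff P = 1" "lead_coeff R = 1" "degree R = degree P"
    and "lin_rec_space P \<subseteq> lin_rec_space R"
  shows "P = R"
proof (rule poly_eqI)
  fix k
  show "coeff P k = coeff R k"
  proof (cases "k < degree P")
    case True
    define c where "c = rec_solution P (\<lambda>n. of_bool (n = k))"
    have c: "c \<in> lin_rec_space P" unfolding c_def using assms(1) by (rule rec_solution_lin_rec)
    have vanish: "(\<Sum>k\<le>degree S. coeff S k * c k) = 0" if "c \<in> lin_rec_space S" for S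
      using spec[OF that[unfolded lin_rec_space_def mem_Collect_eq], of 0] by simp
    have "(\<Sum>k\<le>degree P. coeff P k * c k) = 0" "(\<Sum>k\<le>degree R. coeff R k * c k) = 0"
      using c assms(4) by (blast intro: vanish)+
    then have "(\<Sum>k<degree P. coeff P k * c k) = (\<Sum>k<degree P. coeff R k * c k)"
      using assms(1-3) by (simp add: lessThan_Suc_atMost[symmetric]) (metis add_right_imp_eq)
    then show ?thesis using True
      by (simp add: c_def rec_solution_init of_bool_def if_distrib sum.delta' cong: if_cong)
  next
    case False
    then show ?thesis using assms by (cases "k = degree P") (auto simp: coeff_eq_0)
  qed
qed

section \<open>Iterated operations and products of sequence spaces\<close>

lemma iterated_1 [simp]: "iterated f (Suc 0) g = g (Suc 0)"
  by (simp add: iterated_def)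

lemma iterated_Suc:
  assumes "m \<ge> 1"
  shows "iterated f (Suc m) g = f (iterated f m g) (g (Suc m))"
proof -
  have "[2..<Suc (Suc m)] = [2..<Suc m] @ [Suc m]"
    using assms by (intro upt_Suc_append) simp
  then show ?thesis by (simp add: iterated_def)
qed

lemma seq_space_prod_subspace: "seq.subspace (seq_space_prod V W)"
  by (simp add: seq_space_prod_def seq.subspace_span)

lemma seq_space_prod_memI: "c \<in> V \<Longrightarrow> d \<in> W \<Longrightarrow> c * d \<in> seq_space_prod V W"
  unfolding seq_space_prod_def by (rule seq.span_base) blast

lemma seq_scale_mult_left: "seq_scale a c * d = seq_scale a (c * d)"
  by (simp add: seq_scale_def fun_eq_iff mult_ac)

lemma seq_scale_mult_right: "c * seq_scale a d = seq_scale a (c * d)"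
  by (simp add: seq_scale_def fun_eq_iff mult_ac)

text \<open>Bilinearity of the Hadamard product, by one span induction in each factor.\<close>

lemma seq_space_prod_span:
  "seq_space_prod (seq.span A) (seq.span B) = seq.span {c * d | c d. c \<in> A \<and> d \<in> B}"
proof (rule antisym)
  let ?S = "seq.span {c * d | c d. c \<in> A \<and> d \<in> B}"
  have "c * d \<in> ?S" if "c \<in> seq.span A" "d \<in> seq.span B" for c d
    using that(1)
  proof (induction rule: seq.span_induct_alt)
    case base
    show ?case unfolding mult_zero_left by (rule seq.span_zero)
  next
    case (step x a y)
    have "a * d \<in> ?S"
      using that(2)
    proof (induction rule: seq.span_induct_alt)
      case base
      show ?case unfolding mult_zero_right by (rule seq.span_zero)
    next
      case (step x' b y')
      have "a * b \<in> ?S" by (rule seq.span_base) (use step \<open>a \<in> A\<close> in blast)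
      then show ?case
        using step unfolding distrib_left seq_scale_mult_right
        by (intro seq.span_add seq.span_scale)
    qed
    then show ?case
      using step unfolding distrib_right seq_scale_mult_left
      by (intro seq.span_add seq.span_scale)
  qed
  then show "seq_space_prod (seq.span A) (seq.span B) \<subseteq> ?S"
    unfolding seq_space_prod_def by (intro seq.span_minimal) (auto simp: seq.subspace_span)
  show "?S \<subseteq> seq_space_prod (seq.span A) (seq.span B)"
    unfolding seq_space_prod_def by (intro seq.span_mono) (auto intro: seq.span_base)
qed

section \<open>Nilpotent parts of products and the exponent \<rho>\<close>

text \<open>This is what recovers unit sequences from products: if \<open>w i \<noteq> 0\<close>,
  then \<open>seq_unit i * w\<close> is a nonzero multiple of \<open>seq_unit i\<close>. Unlike
  being nonzero, the property passes to products.\<close>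

definition full_support :: "(nat \<Rightarrow> 'a::field) set \<Rightarrow> bool" where
  "full_support V \<longleftrightarrow> (\<forall>n. \<exists>c\<in>V. c n \<noteq> 0)"

lemma full_support_prod:
  assumes "full_support V" "full_support W"
  shows "full_support (seq_space_prod V W)"
  unfolding full_support_def
proof
  fix n
  obtain c where "c \<in> V" "c n \<noteq> 0"
    using assms(1) unfolding full_support_def by blast
  moreover obtain d where "d \<in> W" "d n \<noteq> 0"
    using assms(2) unfolding full_support_def by blast
  ultimately
  show "\<exists>x\<in>seq_space_prod V W. x n \<noteq> 0"
    by (intro bexI[of _ "c * d"]) (auto intro: seq_space_prod_memI)
qed

lemma seq_space_prod_zero:
  assumes "V = {0} \<or> W = {0}" "V \<noteq> {}" "W \<noteq> {}"
  shows "seq_space_prod V W = {0}"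
proof -
  have "{c * d | c d. c \<in> V \<and> d \<in> W} = {0}" using assms by auto
  then show ?thesis by (simp add: seq_space_prod_def seq.span_insert_0)
qed

lemma not_full_support_zero [simp]: "\<not> full_support {0}"
  by (simp add: full_support_def)

lemma lin_rec_space_monom: "c \<in> lin_rec_space (monom 1 s) \<longleftrightarrow> (\<forall>n\<ge>s. c n = 0)"
proof -
  have "c \<in> lin_rec_space (monom 1 s) \<longleftrightarrow> (\<forall>n. c (n + s) = 0)"
    by (simp add: lin_rec_space_iff fun_eq_iff poly_shift_monom)
  then show ?thesis by (metis le_add2 le_Suc_ex add.commute)
qed

lemma lin_rec_space_shift:
  assumes "c \<in> lin_rec_space P"
  shows "poly_shift R c \<in> lin_rec_space P"
  using assms by (metis lin_rec_space_iff mult.commute poly_shift_mult poly_shift_seq_0)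

lemma monom_bezout:
  assumes "poly Q 0 \<noteq> (0::'a::field)"
  obtains U V where "U * monom 1 s + V * Q = 1"
proof -
  obtain U V where "[:-0, 1:] ^ s * U + Q * V = 1" using power_linear_bezout[OF assms] by blast
  then have "U * monom 1 s + V * Q = 1" by (simp add: monom_altdef mult.commute)
  then show thesis by (rule that)
qed

lemma lin_rec_space_monom_mult:
  assumes "poly Q 0 \<noteq> 0"
  shows "lin_rec_space (monom 1 s * Q) = seq.span (lin_rec_space (monom 1 s) \<union> lin_rec_space Q)"
proof -
  obtain U V where "U * monom 1 s + V * Q = 1" using monom_bezout[OF assms] .
  from lin_rec_space_coprime[OF this] show ?thesis
    unfolding seq.span_Un seq.span_eq_iff[THEN iffD2, OF lin_rec_space_subspace] by blast
qed

text \<open>If every solution vanished at \<open>n\<close>, shift invariance would make a solution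
  \<open>c\<close> vanish from \<open>n\<close> on, so \<open>c\<close> would also lie in
  \<open>L(X^n)\<close>. Since X^n and \<open>Q\<close> are coprime, \<open>c = 0\<close>,
  contradicting the initial value 1.\<close>

lemma full_support_lin_rec_space:
  assumes "lead_coeff Q = 1" "degree Q > 0" "poly Q 0 \<noteq> 0"
  shows "full_support (lin_rec_space Q)"
  unfolding full_support_def
proof (rule allI, rule ccontr)
  fix n
  assume *: "\<not> (\<exists>c\<in>lin_rec_space Q. c n \<noteq> 0)"
  define c where "c = rec_solution Q (\<lambda>_. 1)"
  have c: "c \<in> lin_rec_space Q" unfolding c_def using assms(1) by (rule rec_solution_lin_rec)
  have "c (n + k) = 0" for k
    using lin_rec_space_shift[OF c, of "monom 1 k"] * poly_shift_monom[of k c n] by auto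
  then have "c \<in> lin_rec_space (monom 1 n)" by (auto simp: lin_rec_space_monom le_iff_add)
  moreover obtain U V where "U * monom 1 n + V * Q = 1" using monom_bezout[OF assms(3)] .
  ultimately have "c = 0"
    using c by (metis add.right_neutral lin_rec_space_iff poly_shift_1 poly_shift_add poly_shift_mult poly_shift_seq_0)
  moreover have "c 0 = 1" using assms by (simp add: c_def rec_solution_init)
  ultimately show False by simp
qed

definition seq_unit :: "nat \<Rightarrow> nat \<Rightarrow> 'a::field" where
  "seq_unit i = (\<lambda>n. of_bool (n = i))"

lemma mult_seq_unit: "c * seq_unit i = seq_scale (c i) (seq_unit i)"
  by (auto simp: seq_unit_def seq_scale_def fun_eq_iff)

lemma seq_unit_mult: "seq_unit i * c = seq_scale (c i) (seq_unit i)"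
  by (auto simp: seq_unit_def seq_scale_def fun_eq_iff)

lemma seq_unit_mem: "i < s \<Longrightarrow> seq_unit i \<in> lin_rec_space (monom 1 s)"
  by (auto simp: lin_rec_space_monom seq_unit_def)

lemma sum_seq_apply: "(\<Sum>i\<in>A. f i :: nat \<Rightarrow> 'a::field) n = (\<Sum>i\<in>A. f i n)"
  by (induction A rule: infinite_finite_induct) auto

lemma lin_rec_space_monom_le_span:
  fixes Gen :: "(nat \<Rightarrow> 'a::field) set"
  assumes "\<And>i. i < s \<Longrightarrow> seq_unit i \<in> seq.span Gen"
  shows "lin_rec_space (monom 1 s) \<subseteq> seq.span Gen"
proof
  fix c :: "nat \<Rightarrow> 'a" assume c: "c \<in> lin_rec_space (monom 1 s)"
  have "c = (\<Sum>i<s. seq_scale (c i) (seq_unit i))"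
  proof
    fix n
    have "(\<Sum>i<s. seq_scale (c i) (seq_unit i)) n = (\<Sum>i<s. seq_scale (c i) (seq_unit i) n)"
      by (rule sum_seq_apply)
    also have "\<dots> = (\<Sum>i<s. if i = n then c n else 0)"
      by (intro sum.cong) (auto simp: seq_scale_def seq_unit_def)
    also have "\<dots> = c n" using c by (auto simp: lin_rec_space_monom)
    finally show "c n = (\<Sum>i<s. seq_scale (c i) (seq_unit i)) n" ..
  qed
  also have "\<dots> \<in> seq.span Gen" by (intro seq.span_sum seq.span_scale assms) auto
  finally show "c \<in> seq.span Gen" .
qed

lemma span_unit_of_scale:
  assumes "seq_scale a (seq_unit i) \<in> seq.span Gen" "a \<noteq> (0::'a::field)"
  shows "seq_unit i \<in> seq.span Gen"
  using seq.span_scale[OF assms(1), of "inverse a"] assms(2) by simp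

lemma monic_degree_pos:
  assumes "lead_coeff Q = 1" "Q \<noteq> 1"
  shows "degree Q > 0"
proof (rule Nat.gr0I)
  assume "degree Q = 0"
  then obtain a where "Q = [:a:]" by (rule degree_eq_zeroE)
  then show False using assms by (simp add: one_pCons)
qed

text \<open>The nilpotent exponent of the product of \<open>L(X^a) + V\<close> and
  \<open>L(X^b) + W\<close>, where the flags tell whether \<open>V\<close> and \<open>W\<close> are
  zero. A zero \<open>V\<close> confines all products to the first \<open>a\<close> entries, and a
  zero \<open>W\<close> to the first \<open>b\<close>.\<close>

definition nilpotent_part :: "bool \<Rightarrow> nat \<Rightarrow> bool \<Rightarrow> nat \<Rightarrow> nat" where
  "nilpotent_part v a w b = (if v then if w then min a b else a else if w then b else max a b)"

text \<open>Of the four products of summands, three have a nilpotent factor and consist of sequences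
  supported below \<open>c\<close>; the fourth is the product of \<open>V\<close> and
  \<open>W\<close>. Both inclusions are checked on generators.\<close>

lemma prod_nilpotent_part:
  fixes V W :: "(nat \<Rightarrow> 'a::field) set" and a b :: nat
  assumes V: "V = {0} \<or> full_support V" and W: "W = {0} \<or> full_support W"
  defines "c \<equiv> nilpotent_part (V = {0}) a (W = {0}) b"
  shows "seq_space_prod (seq.span (lin_rec_space (monom 1 a) \<union> V)) (seq.span (lin_rec_space (monom 1 b) \<union> W))
       = seq.span (lin_rec_space (monom 1 c) \<union> seq_space_prod V W)"
proof -
  define Gen where "Gen = {x * y | x y. x \<in> lin_rec_space (monom 1 a) \<union> V \<and> y \<in> lin_rec_space (monom 1 b) \<union> W}"
  define Y where "Y = lin_rec_space (monom 1 c) \<union> seq_space_prod V W"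
  have zero: "(x * 0 :: nat \<Rightarrow> 'a) = 0" "(0 * x :: nat \<Rightarrow> 'a) = 0" for x by simp_all
  have min: "c \<ge> min a b" by (auto simp: c_def nilpotent_part_def)
  have a: "c \<ge> a" if "W \<noteq> {0}" using that by (simp add: c_def nilpotent_part_def)
  have b: "c \<ge> b" if "V \<noteq> {0}" using that by (simp add: c_def nilpotent_part_def)
  have Gen: "x * y \<in> Gen" if "x \<in> lin_rec_space (monom 1 a) \<union> V" "y \<in> lin_rec_space (monom 1 b) \<union> W" for x y
    using that unfolding Gen_def by blast
  have unit: "seq_unit i \<in> seq.span Gen" if ic: "i < c" for i
  proof -
    \<comment> \<open>The ways to produce \<open>seq_unit i\<close>: from two nilpotent factors, or
      from one of them and a sequence of the other space that does not vanish at
      \<open>i\<close>.\<close>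
    consider "i < a" "i < b" | "i < a" "full_support W" | "i < b" "full_support V"
      using ic V W unfolding c_def nilpotent_part_def by (auto split: if_splits simp: less_max_iff_disj)
    then show ?thesis
    proof cases
      case 1
      then have "seq_unit i * seq_unit i \<in> Gen" by (intro Gen UnI1 seq_unit_mem)
      then have "seq_scale 1 (seq_unit i) \<in> seq.span Gen"
        by (simp only: mult_seq_unit) (auto simp: seq_unit_def intro: seq.span_base)
      then show ?thesis by simp
    next
      case 2
      then obtain w where w: "w \<in> W" "w i \<noteq> 0" by (auto simp: full_support_def)
      have "seq_unit i * w \<in> Gen" using w 2 by (intro Gen UnI1 seq_unit_mem UnI2)
      then show ?thesis using w(2)
        by (intro span_unit_of_scale[of "w i"]) (auto simp: seq_unit_mult intro: seq.span_base)
    next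
      case 3
      then obtain w where w: "w \<in> V" "w i \<noteq> 0" by (auto simp: full_support_def)
      have "w * seq_unit i \<in> Gen" using w 3 by (intro Gen UnI1 seq_unit_mem UnI2)
      then show ?thesis using w(2)
        by (intro span_unit_of_scale[of "w i"]) (auto simp: mult_seq_unit intro: seq.span_base)
    qed
  qed
  have "Gen \<subseteq> seq.span Y"
  proof
    fix z assume "z \<in> Gen"
    then obtain x y where z: "z = x * y" and x: "x \<in> lin_rec_space (monom 1 a) \<union> V"
      and y: "y \<in> lin_rec_space (monom 1 b) \<union> W"
      by (auto simp: Gen_def)
    consider "z \<in> lin_rec_space (monom 1 c)" | "x \<in> V" "y \<in> W"
    proof (cases "x \<in> V \<and> y \<in> W")
      case False
      have "z n = 0" if "n \<ge> c" for n
      proof (cases "z = 0")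
        case nz: False
        \<comment> \<open>A nonzero factor from \<open>V\<close> or \<open>W\<close> shows that this
          space is not zero, and then \<open>c\<close> is at least the exponent of the nilpotent
          factor.\<close>
        then have nz': "x \<noteq> 0" "y \<noteq> 0" using z zero by blast+
        consider "x \<in> lin_rec_space (monom 1 a)" "y \<in> lin_rec_space (monom 1 b)"
          | "x \<in> lin_rec_space (monom 1 a)" "y \<in> W" | "x \<in> V" "y \<in> lin_rec_space (monom 1 b)"
          using False x y by blast
        then show ?thesis
        proof cases
          case 1
          then have "x n = 0 \<or> y n = 0"
            using min that unfolding lin_rec_space_monom by (meson le_trans min_le_iff_disj)
          then show ?thesis by (auto simp: z)
        next
          case 2
          then have "W \<noteq> {0}" using nz'(2) by blast
          then have "x n = 0" using 2 a that by (auto simp: lin_rec_space_monom)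
          then show ?thesis by (simp add: z)
        next
          case 3
          then have "V \<noteq> {0}" using nz'(1) by blast
          then have "y n = 0" using 3 b that by (auto simp: lin_rec_space_monom)
          then show ?thesis by (simp add: z)
        qed
      qed simp
      then show ?thesis using that by (auto simp: lin_rec_space_monom)
    qed (use that in blast)
    then show "z \<in> seq.span Y"
      by cases (auto simp: z Y_def intro!: seq.span_base intro: seq_space_prod_memI)
  qed
  moreover have "Y \<subseteq> seq.span Gen"
  proof -
    have "seq_space_prod V W \<subseteq> seq.span Gen"
      unfolding seq_space_prod_def by (intro seq.span_mono) (auto intro: Gen)
    then show ?thesis unfolding Y_def using lin_rec_space_monom_le_span[OF unit] by blast
  qed
  ultimately have "seq.span Gen = seq.span Y"
    by (meson seq.span_minimal seq.subspace_span subset_antisym)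
  then show ?thesis unfolding seq_space_prod_span Gen_def Y_def .
qed

text \<open>Nonzero spaces with disjoint supports have product zero; full support excludes
  this.\<close>

lemma seq_space_prod_eq_zero_iff:
  fixes V W :: "(nat \<Rightarrow> 'a::field) set"
  assumes "V = {0} \<or> full_support V" "W = {0} \<or> full_support W"
  shows "seq_space_prod V W = {0} \<longleftrightarrow> V = {0} \<or> W = {0}"
proof -
  have "A \<noteq> {} \<and> A \<noteq> {0}" if "full_support A" for A :: "(nat \<Rightarrow> 'a) set"
    using that by (auto simp: full_support_def)
  then show ?thesis
    using assms full_support_prod[of V W] seq_space_prod_zero[of V W] by (metis insert_not_empty)
qed

text \<open>The second conjunct is carried along because \<open>prod_nilpotent_part\<close> requires
  the product so far to be zero or of full support. It becomes zero once some \<open>Q i\<close> is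
  1, as \<open>L(1) = 0\<close>.\<close>

lemma iterated_prod_nilpotent_part:
  fixes P Q :: "nat \<Rightarrow> 'a::field poly" and s :: "nat \<Rightarrow> nat"
  assumes "m \<ge> 1"
    and lead: "\<And>i. i \<in> {1..m} \<Longrightarrow> lead_coeff (Q i) = 1"
    and P: "\<And>i. i \<in> {1..m} \<Longrightarrow> P i = monom 1 (s i) * Q i"
    and Q0: "\<And>i. i \<in> {1..m} \<Longrightarrow> poly (Q i) 0 \<noteq> 0"
  defines "\<Theta> \<equiv> {i \<in> {1..m}. Q i = 1}"
  defines "V \<equiv> iterated seq_space_prod m (\<lambda>i. lin_rec_space (Q i))"
  shows "iterated seq_space_prod m (\<lambda>i. lin_rec_space (P i)) =
      seq.span (lin_rec_space (monom 1 (if \<Theta> \<noteq> {} then Min (s ` \<Theta>) else Max (s ` {1..m}))) \<union> V)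
    \<and> (if \<Theta> \<noteq> {} then V = {0} else full_support V)"
  using assms(1-4) unfolding \<Theta>_def V_def
proof (induction m rule: nat_induct_at_least)
  case base
  have "full_support (lin_rec_space (Q 1))" if "Q 1 \<noteq> 1"
    using that base by (intro full_support_lin_rec_space) (auto intro: monic_degree_pos)
  moreover have "{i \<in> {1..1}. Q i = 1} = (if Q 1 = 1 then {1} else {})" by auto
  ultimately show ?case
    using base lin_rec_space_monom_mult[of "Q 1" "s 1"] by (cases "Q 1 = 1") simp_all
next
  case (Suc m)
  define T where "T = {i \<in> {1..m}. Q i = 1}"
  define T' where "T' = {i \<in> {1..Suc m}. Q i = 1}"
  define r where "r = (if T \<noteq> {} then Min (s ` T) else Max (s ` {1..m}))"
  define W where "W = iterated seq_space_prod m (\<lambda>i. lin_rec_space (Q i))"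
  have IH: "iterated seq_space_prod m (\<lambda>i. lin_rec_space (P i)) =
      seq.span (lin_rec_space (monom 1 r) \<union> W)" "if T \<noteq> {} then W = {0} else full_support W"
    using Suc.IH Suc.prems unfolding T_def r_def W_def by simp_all
  let ?q = "Q (Suc m)"
  have T': "T' = (if ?q = 1 then insert (Suc m) T else T)"
    by (auto simp: T_def T'_def atLeastAtMostSuc_conv)
  have fin: "finite T" by (simp add: T_def)
  have W: "W = {0} \<or> full_support W" "W = {0} \<longleftrightarrow> T \<noteq> {}" using IH(2) by (auto split: if_splits)
  have "full_support (lin_rec_space ?q)" if "?q \<noteq> 1"
    using that Suc.prems by (intro full_support_lin_rec_space) (auto intro: monic_degree_pos)
  then have q: "lin_rec_space ?q = {0} \<or> full_support (lin_rec_space ?q)" "lin_rec_space ?q = {0} \<longleftrightarrow> ?q = 1"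
    by (cases "?q = 1"; auto)+
  \<comment> \<open>The flag for \<open>W\<close> records whether an earlier \<open>Q i\<close> is
    1, so the four cases of \<open>nilpotent_part\<close> are the ways in which the minimum or
    maximum changes from \<open>T\<close> to \<open>T'\<close>.\<close>
  have "nilpotent_part (W = {0}) r (lin_rec_space ?q = {0}) (s (Suc m)) =
     (if T' \<noteq> {} then Min (s ` T') else Max (s ` {1..Suc m}))"
  proof -
    have "s ` {1..Suc m} = insert (s (Suc m)) (s ` {1..m})" by (simp add: atLeastAtMostSuc_conv)
    then have "Max (s ` {1..Suc m}) = max (s (Suc m)) (Max (s ` {1..m}))"
      using \<open>1 \<le> m\<close> by simp
    moreover have "Min (s ` insert (Suc m) T) = min (s (Suc m)) (Min (s ` T))" if "T \<noteq> {}"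
      using fin that by simp
    ultimately show ?thesis
      unfolding W(2) q(2) T' r_def nilpotent_part_def by (simp add: min.commute max.commute)
  qed
  moreover have "lin_rec_space (P (Suc m)) =
      seq.span (lin_rec_space (monom 1 (s (Suc m))) \<union> lin_rec_space ?q)"
    using Suc.prems by (simp add: lin_rec_space_monom_mult)
  ultimately have "iterated seq_space_prod (Suc m) (\<lambda>i. lin_rec_space (P i)) =
      seq.span (lin_rec_space (monom 1 (if T' \<noteq> {} then Min (s ` T') else Max (s ` {1..Suc m})))
        \<union> seq_space_prod W (lin_rec_space ?q))"
    using prod_nilpotent_part[OF W(1) q(1), of r "s (Suc m)"]
    by (simp only: iterated_Suc[OF \<open>1 \<le> m\<close>] IH(1))
  moreover have "if T' \<noteq> {} then seq_space_prod W (lin_rec_space ?q) = {0} else full_support (seq_space_prod W (lin_rec_space ?q))"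
    using seq_space_prod_eq_zero_iff[OF W(1) q(1)] full_support_prod[of W "lin_rec_space ?q"] W q
    by (auto simp: T')
  ultimately show ?case
    unfolding T'_def W_def iterated_Suc[OF \<open>1 \<le> m\<close>] by blast
qed

section \<open>Binomial sequences as generators of solution spaces\<close>

text \<open>Binomial coefficients replace powers of \<open>n\<close> so that the description holds
  in every characteristic; in characteristic p the functions \<open>n^p\<close> and \<open>n\<close>
  coincide.\<close>

definition binom_seq :: "'a::field \<Rightarrow> nat \<Rightarrow> nat \<Rightarrow> 'a" where
  "binom_seq g k = (\<lambda>n. of_nat (n choose k) * g ^ n)"

lemma poly_shift_linear: "poly_shift [:-g, 1:] c n = c (Suc n) - g * c n"
  by (simp add: poly_shift_pCons)

lemma poly_shift_linear_binom_seq_0: "poly_shift [:-g, 1:] (binom_seq g 0) = 0"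
  by (auto simp: fun_eq_iff poly_shift_linear binom_seq_def)

text \<open>By Pascal's rule, X - g lowers the index up to the factor \<open>g\<close>.\<close>

lemma poly_shift_linear_binom_seq_Suc:
  "poly_shift [:-g, 1:] (binom_seq g (Suc k)) = seq_scale g (binom_seq g k)"
  by (auto simp: fun_eq_iff poly_shift_linear binom_seq_def seq_scale_def algebra_simps)

text \<open>Solutions for \<open>Suc e\<close> are the sequences that X - g maps to solutions for
  \<open>e\<close>. Lowering maps the larger span onto the smaller, and two preimages differ by a
  geometric sequence, a multiple of \<open>binom_seq g 0\<close>.\<close>

lemma lin_rec_space_linear_power:
  fixes g :: "'a::field"
  assumes "g \<noteq> 0"
  shows "lin_rec_space ([:-g, 1:] ^ e) = seq.span (binom_seq g ` {..<e})"
proof (induction e)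
  case 0
  show ?case by simp
next
  case (Suc e)
  let ?l = "[:-g, 1:]"
  have mem: "c \<in> lin_rec_space (?l ^ Suc e) \<longleftrightarrow> poly_shift ?l c \<in> lin_rec_space (?l ^ e)" for c
    by (simp only: lin_rec_space_iff power_Suc2 poly_shift_mult)
  show ?case
  proof (rule antisym)
    show "seq.span (binom_seq g ` {..<Suc e}) \<subseteq> lin_rec_space (?l ^ Suc e)"
    proof (rule seq.span_minimal[OF _ lin_rec_space_subspace], safe)
      fix k assume "k < Suc e"
      then show "binom_seq g k \<in> lin_rec_space (?l ^ Suc e)"
        unfolding mem Suc.IH
        by (cases k) (auto simp: poly_shift_linear_binom_seq_0 poly_shift_linear_binom_seq_Suc
            intro!: seq.span_zero seq.span_scale intro: seq.span_base)
    qed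
    show "lin_rec_space (?l ^ Suc e) \<subseteq> seq.span (binom_seq g ` {..<Suc e})" (is "_ \<subseteq> ?S")
    proof
      have base: "binom_seq g k \<in> ?S" if "k < Suc e" for k
        using that by (intro seq.span_base) simp
      fix c assume "c \<in> lin_rec_space (?l ^ Suc e)"
      then have "poly_shift ?l c \<in> seq.span (binom_seq g ` {..<e})"
        unfolding mem Suc.IH .
      moreover have "\<exists>y\<in>?S. d = poly_shift ?l y" if "d \<in> seq.span (binom_seq g ` {..<e})" for d
        using that
      proof (induction rule: seq.span_induct_alt)
        case base
        then show ?case by (intro bexI[of _ 0] seq.span_zero) (simp only: poly_shift_seq_0)
      next
        case (step a x d)
        then obtain y k where y: "y \<in> ?S" "d = poly_shift ?l y" "x = binom_seq g k" "k < e" by blast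
        \<comment> \<open>Dividing by \<open>g\<close> cancels the factor introduced by
          lowering.\<close>
        define z where "z = seq_scale (a / g) (binom_seq g (Suc k)) + y"
        have "z \<in> ?S" unfolding z_def using y(1) base[of "Suc k"] y(4)
          by (intro seq.span_add seq.span_scale) simp_all
        moreover have "poly_shift ?l z = seq_scale a x + d"
          using assms unfolding z_def poly_shift_seq_add poly_shift_seq_scale y
            poly_shift_linear_binom_seq_Suc by simp
        ultimately show ?case by metis
      qed
      ultimately obtain y where y: "y \<in> ?S" "poly_shift ?l c = poly_shift ?l y" by blast
      \<comment> \<open>The difference \<open>c - y\<close> is killed by X - g, hence geometric with
        ratio \<open>g\<close>.\<close>
      have diff: "c n - y n = (c 0 - y 0) * g ^ n" for n
      proof (induction n)
        case (Suc n)
        have "c (Suc n) - g * c n = y (Suc n) - g * y n"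
          using y(2) by (metis poly_shift_linear)
        then have "c (Suc n) - y (Suc n) = g * (c n - y n)" by (simp add: algebra_simps)
        then show ?case using Suc by simp
      qed simp
      have "c = seq_scale (c 0 - y 0) (binom_seq g 0) + y"
      proof
        fix n
        show "c n = (seq_scale (c 0 - y 0) (binom_seq g 0) + y) n"
          using diff[of n, unfolded diff_eq_eq] by (simp add: seq_scale_def binom_seq_def)
      qed
      also have "\<dots> \<in> ?S" using y(1) base[of 0]
        by (intro seq.span_add seq.span_scale) simp_all
      finally show "c \<in> ?S" .
    qed
  qed
qed

text \<open>Powers of linear polynomials at distinct points are coprime, so each new point adds its
  own span as a summand.\<close>

lemma lin_rec_space_prod_linear:
  fixes A :: "'a::field set"
  assumes "finite A" "0 \<notin> A"
  shows "lin_rec_space (\<Prod>g\<in>A. [:-g, 1:] ^ e g) = seq.span {binom_seq g k | g k. g \<in> A \<and> k < e g}"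
  using assms
proof (induction A rule: finite_induct)
  case empty
  show ?case by simp
next
  case (insert a A)
  let ?B = "\<Prod>g\<in>A. [:-g, 1:] ^ e g"
  have a0: "a \<noteq> 0" and A0: "0 \<notin> A" using insert by auto
  have "poly ?B a \<noteq> 0" using insert by (auto simp: poly_prod)
  then obtain U V where "U * [:-a, 1:] ^ e a + V * ?B = 1"
    using power_linear_bezout[of ?B a "e a"] by (auto simp: mult.commute)
  from lin_rec_space_coprime[OF this] have "lin_rec_space ([:-a, 1:] ^ e a * ?B) =
      seq.span (binom_seq a ` {..<e a} \<union> {binom_seq g k | g k. g \<in> A \<and> k < e g})"
    unfolding seq.span_Un lin_rec_space_linear_power[OF a0] insert.IH[OF A0] by blast
  also have "binom_seq a ` {..<e a} \<union> {binom_seq g k | g k. g \<in> A \<and> k < e g} =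
      {binom_seq g k | g k. g \<in> insert a A \<and> k < e g}" by blast
  finally show ?case using insert by simp
qed

text \<open>Over an algebraically closed field \<open>Q\<close> is a product over a multiset of
  linear factors, and the order of a root is its count in that multiset.\<close>

lemma monic_alg_closed_factorization:
  fixes Q :: "'a::alg_closed_field poly"
  assumes "lead_coeff Q = 1"
  shows "Q = (\<Prod>g | poly Q g = 0. [:-g, 1:] ^ Polynomial.order g Q)"
proof -
  from assms have "Q \<noteq> 0" by auto
  from alg_closed_imp_factorization[OF this] obtain A where A: "Q = (\<Prod>x\<in>#A. [:-x, 1:])"
    using assms by auto
  have order: "Polynomial.order g (\<Prod>x\<in>#B. [:-x, 1:]) = count B g" for B and g :: 'a
  proof (induction B)
    case (add x B)
    have "(\<Prod>x\<in>#B. [:-x, 1:]) \<noteq> 0" by (auto simp: prod_mset_zero_iff)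
    then have "[:-x, 1:] * (\<Prod>x\<in>#B. [:-x, 1:]) \<noteq> 0" by (intro no_zero_divisors) auto
    moreover have "Polynomial.order g [:-x, 1:] = (if g = x then 1 else 0)"
      using order_power_n_n[of x 1] by (auto intro: order_0I)
    ultimately show ?case using add by (simp add: order_mult del: mult_pCons_left)
  qed simp
  have order: "Polynomial.order g Q = count A g" for g using order[of g A] A by simp
  have roots: "{g. poly Q g = 0} = set_mset A"
    using \<open>Q \<noteq> 0\<close> by (auto simp: order_root order)
  have "Q = (\<Prod>g\<in>set_mset A. [:-g, 1:] ^ count A g)"
    using A by (simp only: image_prod_mset_multiplicity)
  then show ?thesis unfolding roots order .
qed

lemma lin_rec_space_alg_closed:
  fixes Q :: "'a::alg_closed_field poly"
  assumes "lead_coeff Q = 1" "poly Q 0 \<noteq> 0"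
  shows "lin_rec_space Q = seq.span {binom_seq g k | g k. g \<noteq> 0 \<and> k < Polynomial.order g Q}"
proof -
  have "Q \<noteq> 0" using assms by auto
  have "lin_rec_space Q = seq.span {binom_seq g k | g k. g \<in> {g. poly Q g = 0} \<and> k < Polynomial.order g Q}"
    using lin_rec_space_prod_linear[of "{g. poly Q g = 0}" "\<lambda>g. Polynomial.order g Q"]
      monic_alg_closed_factorization[OF assms(1)] assms(2) poly_roots_finite[OF \<open>Q \<noteq> 0\<close>] by simp
  moreover have "{binom_seq g k | g k. g \<in> {g. poly Q g = 0} \<and> k < Polynomial.order g Q} =
      {binom_seq g k | g k. g \<noteq> 0 \<and> k < Polynomial.order g Q}"
  proof -
    have "g \<in> {g. poly Q g = 0} \<and> k < Polynomial.order g Q \<longleftrightarrow> g \<noteq> 0 \<and> k < Polynomial.order g Q" for g k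
      using assms(2) by (auto simp: order_root)
    then show ?thesis by simp
  qed
  ultimately show ?thesis by simp
qed

section \<open>The operation \<open>wedge\<close> and products of binomial sequences\<close>

lemma of_nat_binomial_nonzero:
  assumes "(of_nat (n choose k) :: 'a::semiring_1) \<noteq> 0"
  shows "k \<le> n"
  using assms by (rule contrapos_np) (simp add: binomial_eq_0)

text \<open>The sums \<open>r + s\<close> that occur are closed downwards, so being below the
  maximum means occurring. If \<open>Suc l choose r\<close> is nonzero in the field and
  \<open>r > 0\<close>, Pascal's rule makes \<open>l choose (r - 1)\<close> or
  \<open>l choose r\<close> nonzero, and \<open>r\<close> or \<open>s\<close> drops by one.\<close>

lemma less_wedge_iff:
  "k < wedge TYPE('a::field) i j \<longleftrightarrow>
    (\<exists>r s. r < i \<and> s < j \<and> r + s = k \<and> (of_nat (k choose r) :: 'a) \<noteq> 0)"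
proof (cases "i = 0 \<or> j = 0")
  case False
  define R where "R l \<longleftrightarrow> (\<exists>r s. r < i \<and> s < j \<and> r + s = l \<and> (of_nat (l choose r) :: 'a) \<noteq> 0)" for l
  have pred: "R l" if Rl: "R (Suc l)" for l
  proof -
    obtain r s where rs: "r < i" "s < j" "r + s = Suc l" "(of_nat (Suc l choose r) :: 'a) \<noteq> 0"
      using Rl unfolding R_def by blast
    show ?thesis
    proof (cases r)
      case 0
      then have "0 < i" "l < j" "0 + l = l" "(of_nat (l choose 0) :: 'a) \<noteq> 0" using rs by auto
      then show ?thesis unfolding R_def by blast
    next
      case (Suc r')
      then have "(of_nat (l choose r') :: 'a) \<noteq> 0 \<or> (of_nat (l choose Suc r') :: 'a) \<noteq> 0"
        using rs(4) unfolding Suc binomial_Suc_Suc of_nat_add by fastforce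
      then show ?thesis
      proof
        assume "(of_nat (l choose r') :: 'a) \<noteq> 0"
        moreover have "r' < i" "r' + s = l" using rs Suc by auto
        ultimately show ?thesis unfolding R_def using rs(2) by blast
      next
        assume *: "(of_nat (l choose Suc r') :: 'a) \<noteq> 0"
        \<comment> \<open>Hence \<open>s \<ge> 1\<close>, so \<open>s - 1\<close> is a genuine
          subtraction.\<close>
        then have "r \<le> l" unfolding Suc by (rule of_nat_binomial_nonzero)
        then have "s - 1 < j" "r + (s - 1) = l" using rs by auto
        then show ?thesis unfolding R_def using rs(1) * Suc by blast
      qed
    qed
  qed
  have down: "R k" if "R l" "k \<le> l" for l
    using that(2)
  proof (induction rule: inc_induct)
    case base
    show ?case by fact
  next
    case (step n)
    from \<open>R (Suc n)\<close> show ?case by (rule pred)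
  qed
  \<comment> \<open>Successors, because \<open>wedge\<close> is the maximum of
    \<open>r + s + 1\<close>; thus \<open>k\<close> below it corresponds to \<open>k\<close> itself
    occurring as a sum.\<close>
  define S where "S = {Suc l | l. R l}"
  have "S \<subseteq> {..i + j}" unfolding S_def R_def by auto
  then have fin: "finite S" by (rule finite_subset) simp
  have "0 < i" "0 < j" "(0::nat) + 0 = 0" "(of_nat (0 choose 0) :: 'a) \<noteq> 0" using False by auto
  then have "R 0" unfolding R_def by blast
  have le: "r \<le> i - 1 \<longleftrightarrow> r < i" "s \<le> j - 1 \<longleftrightarrow> s < j" for r s using False by auto
  have "{r + s + 1 | r s. r < i \<and> s < j \<and> (of_nat ((r + s) choose r) :: 'a) \<noteq> 0} = S"
    unfolding S_def R_def Suc_eq_plus1 by blast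
  then have "k < wedge TYPE('a) i j \<longleftrightarrow> k < Max S"
    using False unfolding wedge_def le by simp
  also have "\<dots> \<longleftrightarrow> (\<exists>x\<in>S. k < x)"
    using \<open>R 0\<close> by (intro Max_gr_iff fin) (auto simp: S_def)
  also have "\<dots> \<longleftrightarrow> R k"
  proof
    assume "\<exists>x\<in>S. k < x"
    then obtain l where "R l" "k < Suc l" unfolding S_def by blast
    then show "R k" using down by simp
  qed (auto simp: S_def)
  finally show ?thesis by (simp add: R_def)
qed (auto simp: wedge_def)

lemma wedge_le: "wedge TYPE('a::field) i j \<le> i + j"
proof (rule ccontr)
  assume "\<not> ?thesis"
  then have "i + j < wedge TYPE('a) i j" by simp
  then show False by (auto simp: less_wedge_iff)
qed

lemma wedge_pos: "0 < wedge TYPE('a::field) i j \<Longrightarrow> 0 < i \<and> 0 < j"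
  by (auto simp: less_wedge_iff)

text \<open>Vandermonde's identity, applied to \<open>n choose j = (i + (n - i)) choose j\<close>.\<close>

lemma binomial_mult_binomial:
  "(n choose i) * (n choose j) = (\<Sum>t\<le>i. ((j + t) choose i) * (i choose t) * (n choose (j + t)))"
proof (cases "i \<le> n")
  case False
  then have zero: "((j + t) choose i) * (i choose t) * (n choose (j + t)) = 0" for t
    by (cases "j + t < i") auto
  have "(\<Sum>t\<le>i. ((j + t) choose i) * (i choose t) * (n choose (j + t))) = 0"
    by (simp only: zero sum.neutral_const)
  moreover have "(n choose i) * (n choose j) = 0" using False by (simp add: binomial_eq_0)
  ultimately show ?thesis by presburger
next
  case True
  have "(n choose j) = (\<Sum>u\<le>j. (i choose u) * ((n - i) choose (j - u)))"
    using vandermonde[of i "n - i" j] True by simp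
  also have "\<dots> = (\<Sum>u\<in>{..j} \<inter> {..i}. (i choose u) * ((n - i) choose (j - u)))"
    by (intro sum.mono_neutral_right) auto
  \<comment> \<open>Substitution \<open>u = i - t\<close>; the bound \<open>u \<le> j\<close> turns
    into \<open>i \<le> j + t\<close>.\<close>
  also have "\<dots> = (\<Sum>t\<in>{t. t \<le> i \<and> i \<le> j + t}. (i choose t) * ((n - i) choose (j + t - i)))"
    by (rule sum.reindex_bij_witness[of _ "\<lambda>t. i - t" "\<lambda>t. i - t"])
       (auto simp: binomial_symmetric[symmetric])
  finally have "(n choose i) * (n choose j) =
     (\<Sum>t\<in>{t. t \<le> i \<and> i \<le> j + t}. (i choose t) * ((n choose i) * ((n - i) choose (j + t - i))))"
    by (simp add: sum_distrib_left mult_ac)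
  also have "\<dots> = (\<Sum>t\<in>{t. t \<le> i \<and> i \<le> j + t}. ((j + t) choose i) * (i choose t) * (n choose (j + t)))"
  proof (intro sum.cong refl)
    fix t assume t: "t \<in> {t. t \<le> i \<and> i \<le> j + t}"
    show "(i choose t) * ((n choose i) * ((n - i) choose (j + t - i))) =
       ((j + t) choose i) * (i choose t) * (n choose (j + t))"
    proof (cases "j + t \<le> n")
      case True
      \<comment> \<open>Trinomial revision: choosing \<open>j + t\<close> out of \<open>n\<close>
        and then \<open>i\<close> of these, or the \<open>i\<close> first.\<close>
      then show ?thesis using t choose_mult[of i "j + t" n] by (simp add: mult_ac)
    next
      case False
      then show ?thesis using t \<open>i \<le> n\<close> by (simp add: binomial_eq_0)
    qed
  qed
  also have "\<dots> = (\<Sum>t\<le>i. ((j + t) choose i) * (i choose t) * (n choose (j + t)))"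
    by (intro sum.mono_neutral_left) (auto simp: binomial_eq_0)
  finally show ?thesis .
qed

lemma binom_seq_mult:
  "binom_seq g i * binom_seq h j =
    (\<Sum>t\<le>i. seq_scale (of_nat (((j + t) choose i) * (i choose t))) (binom_seq (g * h) (j + t)))"
proof
  fix n
  have "(binom_seq g i * binom_seq h j) n = of_nat ((n choose i) * (n choose j)) * (g * h) ^ n"
    by (simp add: binom_seq_def power_mult_distrib mult_ac)
  also have "\<dots> = (\<Sum>t\<le>i. of_nat (((j + t) choose i) * (i choose t)) * binom_seq (g * h) (j + t) n)"
    unfolding binomial_mult_binomial by (simp add: binom_seq_def sum_distrib_left mult_ac)
  finally show "(binom_seq g i * binom_seq h j) n =
    (\<Sum>t\<le>i. seq_scale (of_nat (((j + t) choose i) * (i choose t))) (binom_seq (g * h) (j + t))) n"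
    unfolding sum_seq_apply by (simp add: seq_scale_def)
qed

text \<open>A nonzero coefficient forces \<open>(j + t) choose i\<close> to be nonzero, so
  \<open>r = i\<close> and \<open>s = j + t - i\<close> witness the bound on \<open>j + t\<close>;
  here \<open>s \<le> j\<close> because \<open>t \<le> i\<close>.\<close>

lemma binom_seq_mult_mem_span:
  fixes g h :: "'a::field"
  assumes "i < e" "j < f"
  shows "binom_seq g i * binom_seq h j \<in> seq.span (binom_seq (g * h) ` {..<wedge TYPE('a) e f})"
  unfolding binom_seq_mult
proof (rule seq.span_sum)
  fix t assume "t \<in> {..i}"
  show "seq_scale (of_nat (((j + t) choose i) * (i choose t))) (binom_seq (g * h) (j + t))
      \<in> seq.span (binom_seq (g * h) ` {..<wedge TYPE('a) e f})"
  proof (cases "(of_nat ((j + t) choose i) :: 'a) = 0")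
    case True
    then show ?thesis by (simp add: seq.span_zero)
  next
    case False
    then have "i \<le> j + t" by (rule of_nat_binomial_nonzero)
    then have "j + t < wedge TYPE('a) e f"
      unfolding less_wedge_iff using assms \<open>t \<in> {..i}\<close> False
      by (intro exI[of _ i] exI[of _ "j + t - i"]) auto
    then show ?thesis by (intro seq.span_scale seq.span_base) auto
  qed
qed

text \<open>For \<open>r + s = k\<close> the product of the sequences with indices \<open>r\<close>
  and \<open>s\<close> has top term \<open>k\<close> with coefficient \<open>k choose r\<close>,
  nonzero for a suitable \<open>r\<close>. The other indices are smaller, so induction allows
  solving for the top term.\<close>

lemma binom_seq_mem_span_mult:
  fixes g h :: "'a::field"
  assumes "k < wedge TYPE('a) e f"
  shows "binom_seq (g * h) k \<in> seq.span {binom_seq g i * binom_seq h j | i j. i < e \<and> j < f}"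
    (is "_ \<in> seq.span ?G")
  using assms
proof (induction k rule: less_induct)
  case (less k)
  obtain r s where rs: "r < e" "s < f" "r + s = k" "(of_nat (k choose r) :: 'a) \<noteq> 0"
    using less.prems unfolding less_wedge_iff by blast
  define a where "a t = (of_nat (((s + t) choose r) * (r choose t)) :: 'a)" for t
  have a_r: "a r \<noteq> 0" using rs by (simp add: a_def add.commute)
  define y where "y = (\<Sum>t<r. seq_scale (a t) (binom_seq (g * h) (s + t)))"
  have "binom_seq g r * binom_seq h s = y + seq_scale (a r) (binom_seq (g * h) k)"
    unfolding binom_seq_mult y_def a_def rs(3)[symmetric]
    by (simp only: lessThan_Suc_atMost[symmetric] sum.lessThan_Suc add.commute[of s r])
  then have "seq_scale (a r) (binom_seq (g * h) k) = binom_seq g r * binom_seq h s - y" by simp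
  also have "\<dots> \<in> seq.span ?G"
  proof (rule seq.span_diff)
    show "binom_seq g r * binom_seq h s \<in> seq.span ?G"
      by (rule seq.span_base) (use rs in blast)
    show "y \<in> seq.span ?G"
      unfolding y_def using rs less.prems
      by (intro seq.span_sum seq.span_scale less.IH) auto
  qed
  finally have "seq_scale (inverse (a r)) (seq_scale (a r) (binom_seq (g * h) k)) \<in> seq.span ?G"
    by (rule seq.span_scale)
  then show ?case unfolding seq.scale_scale left_inverse[OF a_r] seq.scale_one .
qed

section \<open>Iterated products over an algebraically closed field\<close>

lemma iterated_cong:
  assumes "m \<ge> 1" "\<And>i. i \<in> {1..m} \<Longrightarrow> g i = g' i"
  shows "iterated f m g = iterated f m g'"
  using assms by (induction m rule: nat_induct_at_least) (simp_all add: iterated_Suc)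

text \<open>Induction on \<open>m\<close>, adjoining one entry to the tuple. The inclusions come
  from \<open>binom_seq_mult_mem_span\<close> and \<open>binom_seq_mem_span_mult\<close>, applied to
  the \<open>wedge\<close> value accumulated so far and the multiplicity of the new entry.\<close>

lemma iterated_prod_alg_closed:
  fixes Q :: "nat \<Rightarrow> 'a::alg_closed_field poly"
  assumes "m \<ge> 1"
    and "\<And>i. i \<in> {1..m} \<Longrightarrow> lead_coeff (Q i) = 1"
    and "\<And>i. i \<in> {1..m} \<Longrightarrow> poly (Q i) 0 \<noteq> 0"
  shows "iterated seq_space_prod m (\<lambda>i. lin_rec_space (Q i)) =
    seq.span {binom_seq (\<Prod>i\<in>{1..m}. \<Lambda> i) k | \<Lambda> k. (\<forall>i\<in>{1..m}. \<Lambda> i \<noteq> 0) \<and>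
      k < iterated (wedge TYPE('a)) m (\<lambda>i. Polynomial.order (\<Lambda> i) (Q i))}"
  using assms
proof (induction m rule: nat_induct_at_least)
  case base
  have "{binom_seq g k | g k. g \<noteq> 0 \<and> k < Polynomial.order g (Q 1)} =
    {binom_seq (\<Lambda> (1::nat)) k | \<Lambda> k. \<Lambda> 1 \<noteq> 0 \<and> k < Polynomial.order (\<Lambda> 1) (Q 1)}" (is "?A = ?B")
  proof
    show "?A \<subseteq> ?B"
    proof safe
      fix g :: 'a and k
      assume "g \<noteq> 0" "k < Polynomial.order g (Q 1)"
      then show "\<exists>\<Lambda> k'. binom_seq g k = binom_seq (\<Lambda> (1::nat)) k' \<and> \<Lambda> 1 \<noteq> 0 \<and> k' < Polynomial.order (\<Lambda> 1) (Q 1)"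
        by (intro exI[of _ "\<lambda>_. g"] exI[of _ k]) simp
    qed
  qed blast
  then show ?case using lin_rec_space_alg_closed[of "Q 1"] base by simp
next
  case (Suc m)
  define G where "G n = {binom_seq (\<Prod>i\<in>{1..n}. \<Lambda> i) k | \<Lambda> k. (\<forall>i\<in>{1..n}. \<Lambda> i \<noteq> 0) \<and>
      k < iterated (wedge TYPE('a)) n (\<lambda>i. Polynomial.order (\<Lambda> i) (Q i))}" for n
  define H where "H = {binom_seq g k | g k. g \<noteq> 0 \<and> k < Polynomial.order g (Q (Suc m))}"
  have "iterated seq_space_prod m (\<lambda>i. lin_rec_space (Q i)) = seq.span (G m)"
    unfolding G_def by (rule Suc.IH) (use Suc.prems in auto)
  moreover have "lin_rec_space (Q (Suc m)) = seq.span H"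
    unfolding H_def by (rule lin_rec_space_alg_closed) (use Suc.prems in auto)
  ultimately have "iterated seq_space_prod (Suc m) (\<lambda>i. lin_rec_space (Q i)) =
      seq.span {c * d | c d. c \<in> G m \<and> d \<in> H}"
    using Suc.hyps by (simp only: iterated_Suc seq_space_prod_span)
  also have "\<dots> = seq.span (G (Suc m))"
  proof (rule antisym; rule seq.span_minimal[OF _ seq.subspace_span]; rule subsetI)
    fix x assume "x \<in> {c * d | c d. c \<in> G m \<and> d \<in> H}"
    then obtain \<Lambda> k g l where \<Lambda>: "\<forall>i\<in>{1..m}. \<Lambda> i \<noteq> 0"
      and k: "k < iterated (wedge TYPE('a)) m (\<lambda>i. Polynomial.order (\<Lambda> i) (Q i))"
      and g: "g \<noteq> 0" and l: "l < Polynomial.order g (Q (Suc m))"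
      and x: "x = binom_seq (\<Prod>i\<in>{1..m}. \<Lambda> i) k * binom_seq g l"
      unfolding G_def H_def by blast
    \<comment> \<open>Appending \<open>g\<close> at position \<open>Suc m\<close> leaves the
      accumulated value for the first \<open>m\<close> positions unchanged.\<close>
    define M where "M = \<Lambda>(Suc m := g)"
    have prod: "(\<Prod>i\<in>{1..Suc m}. M i) = (\<Prod>i\<in>{1..m}. \<Lambda> i) * g"
      by (simp add: M_def atLeastAtMostSuc_conv)
    have "iterated (wedge TYPE('a)) m (\<lambda>i. Polynomial.order (M i) (Q i)) =
        iterated (wedge TYPE('a)) m (\<lambda>i. Polynomial.order (\<Lambda> i) (Q i))"
      using Suc.hyps by (intro iterated_cong) (auto simp: M_def)
    then have w: "iterated (wedge TYPE('a)) (Suc m) (\<lambda>i. Polynomial.order (M i) (Q i)) =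
       wedge TYPE('a) (iterated (wedge TYPE('a)) m (\<lambda>i. Polynomial.order (\<Lambda> i) (Q i)))
         (Polynomial.order g (Q (Suc m)))"
      using Suc.hyps by (simp only: iterated_Suc) (simp add: M_def)
    have "\<forall>i\<in>{1..Suc m}. M i \<noteq> 0" using \<Lambda> g by (auto simp: M_def)
    then have "binom_seq ((\<Prod>i\<in>{1..m}. \<Lambda> i) * g) `
        {..<wedge TYPE('a) (iterated (wedge TYPE('a)) m (\<lambda>i. Polynomial.order (\<Lambda> i) (Q i)))
         (Polynomial.order g (Q (Suc m)))} \<subseteq> G (Suc m)"
      unfolding G_def prod[symmetric] w[symmetric] by blast
    then show "x \<in> seq.span (G (Suc m))"
      unfolding x using binom_seq_mult_mem_span[OF k l] seq.span_mono by blast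
  next
    fix x assume "x \<in> G (Suc m)"
    then obtain \<Lambda> k where \<Lambda>: "\<forall>i\<in>{1..Suc m}. \<Lambda> i \<noteq> 0"
      and k: "k < iterated (wedge TYPE('a)) (Suc m) (\<lambda>i. Polynomial.order (\<Lambda> i) (Q i))"
      and x: "x = binom_seq (\<Prod>i\<in>{1..Suc m}. \<Lambda> i) k"
      unfolding G_def by blast
    define p where "p = (\<Prod>i\<in>{1..m}. \<Lambda> i)"
    have x: "x = binom_seq (p * \<Lambda> (Suc m)) k"
      unfolding x p_def by (simp add: atLeastAtMostSuc_conv mult.commute)
    let ?e = "iterated (wedge TYPE('a)) m (\<lambda>i. Polynomial.order (\<Lambda> i) (Q i))"
    let ?f = "Polynomial.order (\<Lambda> (Suc m)) (Q (Suc m))"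
    let ?B = "{binom_seq p i * binom_seq (\<Lambda> (Suc m)) j | i j. i < ?e \<and> j < ?f}"
    have "k < wedge TYPE('a) ?e ?f" using k Suc.hyps by (simp only: iterated_Suc)
    from binom_seq_mem_span_mult[OF this, of p "\<Lambda> (Suc m)"]
    have "x \<in> seq.span ?B" by (simp only: x)
    moreover have "binom_seq p i \<in> G m" if "i < ?e" for i
      unfolding G_def p_def using \<Lambda> that by fastforce
    moreover have "binom_seq (\<Lambda> (Suc m)) j \<in> H" if "j < ?f" for j
      unfolding H_def using \<Lambda> that by fastforce
    ultimately show "x \<in> seq.span {c * d | c d. c \<in> G m \<and> d \<in> H}"
      using seq.span_mono[of ?B "{c * d | c d. c \<in> G m \<and> d \<in> H}"] by blast
  qed
  finally show ?case by (simp only: G_def)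
qed

section \<open>The exponents of \<Upsilon> and its solution space\<close>

lemma iterated_wedge_le:
  assumes "m \<ge> 1"
  shows "iterated (wedge TYPE('a::field)) m g \<le> (\<Sum>i\<in>{1..m}. g i)"
  using assms
proof (induction m rule: nat_induct_at_least)
  case (Suc m)
  show ?case
    using wedge_le[where 'a = 'a, of "iterated (wedge TYPE('a)) m g" "g (Suc m)"] Suc
    by (simp add: iterated_Suc atLeastAtMostSuc_conv)
qed simp

lemma iterated_wedge_pos:
  assumes "m \<ge> 1" "0 < iterated (wedge TYPE('a::field)) m g" "i \<in> {1..m}"
  shows "0 < g i"
  using assms
proof (induction m rule: nat_induct_at_least)
  case (Suc m)
  then show ?case
    using wedge_pos[where 'a = 'a, of "iterated (wedge TYPE('a)) m g" "g (Suc m)"]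
    by (cases "i = Suc m") (auto simp: iterated_Suc)
qed auto

text \<open>The maximum is attained: the set of values is nonempty, and it is finite because each
  value is at most the sum of the degrees.\<close>

lemma less_upsilon_exponent_iff:
  fixes Q :: "nat \<Rightarrow> 'a::field poly"
  assumes "m \<ge> 1" "\<And>i. i \<in> {1..m} \<Longrightarrow> Q i \<noteq> 0" "\<gamma> \<noteq> 0"
  shows "k < upsilon_exponent m Q \<gamma> \<longleftrightarrow>
    (\<exists>\<Lambda>. (\<forall>i\<in>{1..m}. \<Lambda> i \<noteq> 0) \<and> (\<Prod>i\<in>{1..m}. \<Lambda> i) = \<gamma> \<and>
      k < iterated (wedge TYPE('a)) m (\<lambda>i. Polynomial.order (\<Lambda> i) (map_poly to_ac (Q i))))"
proof -
  define S where "S = {iterated (wedge TYPE('a)) m (\<lambda>i. Polynomial.order (\<Lambda> i) (map_poly to_ac (Q i))) | \<Lambda>.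
            (\<forall>i\<in>{1..m}. \<Lambda> i \<noteq> 0) \<and> (\<Prod>i\<in>{1..m}. \<Lambda> i) = \<gamma>}"
  have nz: "map_poly to_ac (Q i) \<noteq> 0" if "i \<in> {1..m}" for i
    using assms(2)[OF that] by (simp add: map_poly_eq_0_iff)
  have "S \<subseteq> {..\<Sum>i\<in>{1..m}. degree (Q i)}"
  proof
    fix x assume "x \<in> S"
    then obtain \<Lambda> where "x = iterated (wedge TYPE('a)) m (\<lambda>i. Polynomial.order (\<Lambda> i) (map_poly to_ac (Q i)))"
      unfolding S_def by blast
    also have "\<dots> \<le> (\<Sum>i\<in>{1..m}. Polynomial.order (\<Lambda> i) (map_poly to_ac (Q i)))"
      by (rule iterated_wedge_le) fact
    also have "\<dots> \<le> (\<Sum>i\<in>{1..m}. degree (Q i))"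
      using order_degree[OF nz] by (intro sum_mono) (simp add: degree_map_poly)
    finally show "x \<in> {..\<Sum>i\<in>{1..m}. degree (Q i)}" by simp
  qed
  then have fin: "finite S" by (rule finite_subset) simp
  have "S \<noteq> {}"
  proof -
    \<comment> \<open>The tuple \<gamma>, 1, ..., 1 has product \<gamma>, so the set is
      nonempty.\<close>
    define \<Lambda> where "\<Lambda> i = (if i = 1 then \<gamma> else 1)" for i :: nat
    have "\<forall>i\<in>{1..m}. \<Lambda> i \<noteq> 0" using assms by (simp add: \<Lambda>_def)
    moreover have "(\<Prod>i\<in>{1..m}. \<Lambda> i) = \<gamma>"
      using assms(1) by (simp add: \<Lambda>_def prod.delta)
    ultimately show ?thesis unfolding S_def by blast
  qed
  then have "k < Max S \<longleftrightarrow> (\<exists>x\<in>S. k < x)" by (rule Max_gr_iff[OF fin])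
  then show ?thesis unfolding upsilon_exponent_def S_def by blast
qed

text \<open>A positive exponent comes from a tuple of positive multiplicities, so \<gamma> is a
  product of roots, one of each \<open>Q i\<close>.\<close>

lemma finite_upsilon_support:
  fixes Q :: "nat \<Rightarrow> 'a::field poly"
  assumes "m \<ge> 1" "\<And>i. i \<in> {1..m} \<Longrightarrow> Q i \<noteq> 0"
  shows "finite {\<gamma>. \<gamma> \<noteq> 0 \<and> upsilon_exponent m Q \<gamma> \<noteq> 0}"
proof (rule finite_subset)
  let ?R = "\<lambda>i. {g. poly (map_poly to_ac (Q i)) g = 0}"
  have nz: "map_poly to_ac (Q i) \<noteq> 0" if "i \<in> {1..m}" for i
    using assms(2)[OF that] by (simp add: map_poly_eq_0_iff)
  show "finite ((\<lambda>\<Lambda>. \<Prod>i\<in>{1..m}. \<Lambda> i) ` (\<Pi>\<^sub>E i\<in>{1..m}. ?R i))"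
    using nz by (intro finite_imageI finite_PiE) (auto intro: poly_roots_finite)
  show "{\<gamma>. \<gamma> \<noteq> 0 \<and> upsilon_exponent m Q \<gamma> \<noteq> 0} \<subseteq> (\<lambda>\<Lambda>. \<Prod>i\<in>{1..m}. \<Lambda> i) ` (\<Pi>\<^sub>E i\<in>{1..m}. ?R i)"
  proof
    fix \<gamma> assume "\<gamma> \<in> {\<gamma>. \<gamma> \<noteq> 0 \<and> upsilon_exponent m Q \<gamma> \<noteq> 0}"
    then have "\<gamma> \<noteq> 0" "upsilon_exponent m Q \<gamma> \<noteq> 0" by simp_all
    then have "0 < upsilon_exponent m Q \<gamma>" by simp
    then obtain \<Lambda> where \<Lambda>: "(\<Prod>i\<in>{1..m}. \<Lambda> i) = \<gamma>"
      "0 < iterated (wedge TYPE('a)) m (\<lambda>i. Polynomial.order (\<Lambda> i) (map_poly to_ac (Q i)))"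
      using less_upsilon_exponent_iff[of m Q \<gamma> 0] assms \<open>\<gamma> \<noteq> 0\<close> by blast
    have "\<Lambda> i \<in> ?R i" if "i \<in> {1..m}" for i
      using iterated_wedge_pos[OF assms(1) \<Lambda>(2) that] by (auto simp: order_root)
    \<comment> \<open>Values outside \<open>{1..m}\<close> are normalised, which leaves finitely
      many tuples of roots.\<close>
    then have "restrict \<Lambda> {1..m} \<in> (\<Pi>\<^sub>E i\<in>{1..m}. ?R i)" by auto
    moreover have "\<gamma> = (\<Prod>i\<in>{1..m}. restrict \<Lambda> {1..m} i)"
      unfolding \<Lambda>(1)[symmetric] by (intro prod.cong) auto
    ultimately show "\<gamma> \<in> (\<lambda>\<Lambda>. \<Prod>i\<in>{1..m}. \<Lambda> i) ` (\<Pi>\<^sub>E i\<in>{1..m}. ?R i)" by blast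
  qed
qed

text \<open>Only the vanishing of integers in the field matters, and \<open>to_ac\<close> preserves
  and reflects it.\<close>

lemma wedge_alg_closure: "wedge TYPE('a::field alg_closure) = wedge TYPE('a)"
proof (intro ext)
  fix i j
  have of_nat: "(of_nat n :: 'a alg_closure) = 0 \<longleftrightarrow> (of_nat n :: 'a) = 0" for n
    using to_ac_eq_0_iff[of "of_nat n :: 'a"] by simp
  have "\<And>k. k < wedge TYPE('a alg_closure) i j \<longleftrightarrow> k < wedge TYPE('a) i j"
    by (simp add: less_wedge_iff of_nat)
  then show "wedge TYPE('a alg_closure) i j = wedge TYPE('a) i j"
    by (meson antisym leI less_irrefl)
qed

lemma prod_nonzeroI:
  fixes f :: "'b \<Rightarrow> 'c::{comm_semiring_1,semiring_no_zero_divisors}"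
  assumes "\<And>x. x \<in> A \<Longrightarrow> f x \<noteq> 0"
  shows "prod f A \<noteq> 0"
  using assms by (induction A rule: infinite_finite_induct) auto

lemma monic_upsilon_ac: "lead_coeff (upsilon_ac m Q) = 1"
  unfolding upsilon_ac_def by (simp add: lead_coeff_prod lead_coeff_power)

text \<open>Both sides are spanned by binomial sequences. Grouping the tuples by their product
  \<gamma> leaves the indices below the largest value, which is the exponent of \<gamma>.\<close>

lemma iterated_prod_eq_upsilon_ac:
  fixes Q :: "nat \<Rightarrow> 'a::field poly"
  assumes "m \<ge> 1"
    and "\<And>i. i \<in> {1..m} \<Longrightarrow> lead_coeff (Q i) = 1"
    and "\<And>i. i \<in> {1..m} \<Longrightarrow> poly (Q i) 0 \<noteq> 0"
  shows "iterated seq_space_prod m (\<lambda>i. lin_rec_space (map_poly to_ac (Q i))) = lin_rec_space (upsilon_ac m Q)"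
proof -
  have nz: "Q i \<noteq> 0" if "i \<in> {1..m}" for i using assms(2)[OF that] by auto
  let ?it = "\<lambda>\<Lambda>. iterated (wedge TYPE('a)) m (\<lambda>i. Polynomial.order (\<Lambda> i) (map_poly to_ac (Q i)))"
  have "poly (map_poly to_ac (Q i)) 0 \<noteq> 0" if "i \<in> {1..m}" for i
    using assms(3)[OF that] by (simp add: poly_0_coeff_0 coeff_map_poly)
  moreover have "lead_coeff (map_poly to_ac (Q i)) = 1" if "i \<in> {1..m}" for i
    using assms(2)[OF that] by (simp add: degree_map_poly coeff_map_poly)
  ultimately have "iterated seq_space_prod m (\<lambda>i. lin_rec_space (map_poly to_ac (Q i))) =
    seq.span {binom_seq (\<Prod>i\<in>{1..m}. \<Lambda> i) k | \<Lambda> k. (\<forall>i\<in>{1..m}. \<Lambda> i \<noteq> 0) \<and> k < ?it \<Lambda>}"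
    using iterated_prod_alg_closed[OF assms(1), of "\<lambda>i. map_poly to_ac (Q i)"]
    unfolding wedge_alg_closure by blast
  also have "{binom_seq (\<Prod>i\<in>{1..m}. \<Lambda> i) k | \<Lambda> k. (\<forall>i\<in>{1..m}. \<Lambda> i \<noteq> 0) \<and> k < ?it \<Lambda>} =
    {binom_seq \<gamma> k | \<gamma> k. \<gamma> \<in> {\<gamma>. \<gamma> \<noteq> 0 \<and> upsilon_exponent m Q \<gamma> \<noteq> 0} \<and> k < upsilon_exponent m Q \<gamma>}"
    (is "?A = ?B")
  proof
    show "?A \<subseteq> ?B"
    proof
      fix x assume "x \<in> ?A"
      then obtain \<Lambda> k where \<Lambda>: "\<forall>i\<in>{1..m}. \<Lambda> i \<noteq> 0" "k < ?it \<Lambda>" and x: "x = binom_seq (\<Prod>i\<in>{1..m}. \<Lambda> i) k"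
        by blast
      have "(\<Prod>i\<in>{1..m}. \<Lambda> i) \<noteq> 0" using \<Lambda>(1) by simp
      moreover from this have "k < upsilon_exponent m Q (\<Prod>i\<in>{1..m}. \<Lambda> i)"
        using less_upsilon_exponent_iff[of m Q "\<Prod>i\<in>{1..m}. \<Lambda> i" k] assms(1) nz \<Lambda> by blast
      ultimately show "x \<in> ?B" unfolding x by fastforce
    qed
    show "?B \<subseteq> ?A"
    proof
      fix x assume "x \<in> ?B"
      then obtain \<gamma> k where "\<gamma> \<noteq> 0" "k < upsilon_exponent m Q \<gamma>" and x: "x = binom_seq \<gamma> k" by blast
      then show "x \<in> ?A"
        using less_upsilon_exponent_iff[of m Q \<gamma> k] assms(1) nz by blast
    qed
  qed
  also have "seq.span \<dots> = lin_rec_space (upsilon_ac m Q)"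
    unfolding upsilon_ac_def
    by (rule lin_rec_space_prod_linear[symmetric]) (use finite_upsilon_support[of m Q] assms(1) nz in auto)
  finally show ?thesis .
qed

section \<open>Extension of scalars to the algebraic closure and descent\<close>

definition seq_ac :: "(nat \<Rightarrow> 'a::field) \<Rightarrow> nat \<Rightarrow> 'a alg_closure" where
  "seq_ac c = (\<lambda>n. to_ac (c n))"

lemma seq_ac_add: "seq_ac (c + d) = seq_ac c + seq_ac d"
  and seq_ac_mult: "seq_ac (c * d) = seq_ac c * seq_ac d"
  and seq_ac_scale: "seq_ac (seq_scale a c) = seq_scale (to_ac a) (seq_ac c)"
  and seq_ac_0: "seq_ac 0 = 0"
  by (simp_all add: seq_ac_def seq_scale_def fun_eq_iff)

lemma seq_ac_mem_lin_rec_space: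
  "seq_ac c \<in> lin_rec_space (map_poly to_ac P) \<longleftrightarrow> c \<in> lin_rec_space P"
proof -
  have "poly_shift (map_poly to_ac P) (seq_ac c) n = to_ac (poly_shift P c n)" for n
    by (simp add: poly_shift_def seq_ac_def degree_map_poly coeff_map_poly to_ac_sum)
  then show ?thesis by (simp add: lin_rec_space_iff fun_eq_iff)
qed

text \<open>A solution over the closure is determined by its first \<open>degree P\<close> entries,
  hence is the combination, with these entries as coefficients, of the solutions over the base field
  with unit vectors as initial values.\<close>

lemma span_seq_ac_lin_rec_space:
  fixes P :: "'a::field poly"
  assumes "lead_coeff P = 1"
  shows "lin_rec_space (map_poly to_ac P) = seq.span (seq_ac ` lin_rec_space P)"
proof
  show "seq.span (seq_ac ` lin_rec_space P) \<subseteq> lin_rec_space (map_poly to_ac P)"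
    by (rule seq.span_minimal[OF _ lin_rec_space_subspace]) (auto simp: seq_ac_mem_lin_rec_space)
  show "lin_rec_space (map_poly to_ac P) \<subseteq> seq.span (seq_ac ` lin_rec_space P)"
  proof
    fix c assume c: "c \<in> lin_rec_space (map_poly to_ac P)"
    define b where "b k = rec_solution P (\<lambda>n. of_bool (n = k))" for k
    define d where "d = (\<Sum>k<degree P. seq_scale (c k) (seq_ac (b k)))"
    have b: "b k \<in> lin_rec_space P" for k unfolding b_def by (rule rec_solution_lin_rec) fact
    have "d \<in> seq.span (seq_ac ` lin_rec_space P)"
      unfolding d_def by (intro seq.span_sum seq.span_scale seq.span_base imageI b)
    moreover have "c = d"
    proof (rule lin_rec_space_init_eq[OF _ c])
      show "lead_coeff (map_poly to_ac P) = 1" using assms by (simp add: degree_map_poly coeff_map_poly)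
      show "d \<in> lin_rec_space (map_poly to_ac P)"
        unfolding d_def
        by (intro seq.subspace_sum seq.subspace_scale lin_rec_space_subspace) (simp add: seq_ac_mem_lin_rec_space b)
      fix n assume "n < degree (map_poly to_ac P)"
      then have n: "n < degree P" by (simp add: degree_map_poly)
      have "d n = (\<Sum>k<degree P. if k = n then c n else 0)"
        unfolding d_def sum_seq_apply using n
        by (intro sum.cong) (auto simp: seq_scale_def seq_ac_def b_def rec_solution_init)
      then show "c n = d n" using n by simp
    qed
    ultimately show "c \<in> seq.span (seq_ac ` lin_rec_space P)" by simp
  qed
qed

text \<open>As \<open>seq_ac\<close> is multiplicative, both sides are spanned by the products of
  embedded members of \<open>V\<close> and \<open>W\<close>.\<close>

lemma span_seq_ac_prod:
  "seq.span (seq_ac ` seq_space_prod V W) = seq_space_prod (seq.span (seq_ac ` V)) (seq.span (seq_ac ` W))"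
proof -
  let ?B = "{x * y | x y. x \<in> seq_ac ` V \<and> y \<in> seq_ac ` W}"
  have "seq_ac x \<in> seq.span ?B" if "x \<in> seq_space_prod V W" for x
    using that unfolding seq_space_prod_def
  proof (induction rule: seq.span_induct_alt)
    case base
    then show ?case unfolding seq_ac_0 by (rule seq.span_zero)
  next
    case (step a x y)
    then obtain c d where "c \<in> V" "d \<in> W" "x = c * d" by blast
    then have "seq_ac x \<in> ?B" using seq_ac_mult by blast
    then show ?case unfolding seq_ac_add seq_ac_scale
      by (intro seq.span_add seq.span_scale step seq.span_base)
  qed
  then have le: "seq_ac ` seq_space_prod V W \<subseteq> seq.span ?B" by blast
  have ge: "?B \<subseteq> seq_ac ` seq_space_prod V W"
  proof
    fix z assume "z \<in> ?B"
    then obtain c d where "c \<in> V" "d \<in> W" "z = seq_ac c * seq_ac d" by blast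
    then show "z \<in> seq_ac ` seq_space_prod V W"
      by (simp only: seq_ac_mult[symmetric] imageI seq_space_prod_memI)
  qed
  have "seq.span (seq_ac ` seq_space_prod V W) = seq.span ?B"
    using seq.span_minimal[OF le seq.subspace_span] seq.span_mono[OF ge] by (rule antisym)
  then show ?thesis unfolding seq_space_prod_span .
qed

lemma iterated_span_seq_ac:
  assumes "m \<ge> 1"
  shows "iterated seq_space_prod m (\<lambda>i. seq.span (seq_ac ` V i)) =
    seq.span (seq_ac ` iterated seq_space_prod m V)"
  using assms
proof (induction m rule: nat_induct_at_least)
  case (Suc m)
  then show ?case by (simp only: iterated_Suc span_seq_ac_prod)
qed simp

text \<open>In the closure, viewed as a vector space over the base field, 1 is independent; a linear
  functional with value 1 there is the retraction.\<close>

lemma ex_to_ac_retraction: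
  obtains \<pi> :: "'a::field alg_closure \<Rightarrow> 'a"
  where "\<And>x y. \<pi> (x + y) = \<pi> x + \<pi> y" "\<And>a x. \<pi> (to_ac a * x) = a * \<pi> x" "\<And>a. \<pi> (to_ac a) = a"
proof -
  interpret vector_space_pair "\<lambda>(a::'a) x. to_ac a * x" "(*) :: 'a \<Rightarrow> 'a \<Rightarrow> 'a"
    by unfold_locales (simp_all add: algebra_simps)
  have "vs1.independent {1}" by simp
  from linear_independent_extend[OF this, of "\<lambda>_. 1"] obtain \<pi> where \<pi>:
    "Vector_Spaces.linear (\<lambda>(a::'a) x. to_ac a * x) ((*) :: 'a \<Rightarrow> 'a \<Rightarrow> 'a) \<pi>" "\<pi> 1 = 1" by auto
  then have scale: "\<pi> (to_ac a * x) = a * \<pi> x" for a x using linear_scale by blast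
  moreover have "\<pi> (to_ac a) = a" for a using scale[of a 1] \<pi>(2) by simp
  moreover have "\<pi> (x + y) = \<pi> x + \<pi> y" for x y using linear_add[OF \<pi>(1)] .
  ultimately show thesis using that by blast
qed

text \<open>
  Applying a retraction to the coefficients of the monic polynomial \<open>T\<close> gives a monic polynomial
  over the base field which still annihilates \<open>W\<close>; since \<open>T\<close> is determined by its solution space,
  it is already defined over the base field.
\<close>

lemma lin_rec_space_descent:
  fixes W :: "(nat \<Rightarrow> 'a::field) set" and T :: "'a alg_closure poly"
  assumes W: "seq.subspace W" and T: "lead_coeff T = 1"
    and span: "lin_rec_space T = seq.span (seq_ac ` W)"
  obtains R where "map_poly to_ac R = T" "lead_coeff R = 1" "lin_rec_space R = W"
proof -
  obtain \<pi> :: "'a alg_closure \<Rightarrow> 'a" where add: "\<And>x y. \<pi> (x + y) = \<pi> x + \<pi> y"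
    and scale: "\<And>a x. \<pi> (to_ac a * x) = a * \<pi> x" and retract: "\<And>a. \<pi> (to_ac a) = a"
    using ex_to_ac_retraction by blast
  have \<pi>0: "\<pi> 0 = 0" and \<pi>1: "\<pi> 1 = 1" using retract[of 0] retract[of 1] by simp_all
  have \<pi>sum: "\<pi> (\<Sum>i\<in>A. f i) = (\<Sum>i\<in>A. \<pi> (f i))" for A and f :: "nat \<Rightarrow> 'a alg_closure"
    by (induction A rule: infinite_finite_induct) (simp_all add: \<pi>0 add)
  have scale': "\<pi> (x * to_ac a) = \<pi> x * a" for x a
    using scale[of a x] by (simp add: mult.commute)
  define R where "R = map_poly \<pi> T"
  \<comment> \<open>The leading coefficient survives \<pi>, so the degree does not drop.\<close>
  have "\<pi> (lead_coeff T) = 1" using T \<pi>1 by simp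
  then have deg: "degree R = degree T" unfolding R_def using \<pi>0
    by (intro map_poly_degree_eq) simp
  have lead: "lead_coeff R = 1"
    unfolding deg unfolding R_def using T \<pi>0 \<pi>1 by (simp add: coeff_map_poly)
  have W_R: "c \<in> lin_rec_space R" if "c \<in> W" for c
  proof -
    have "seq_ac c \<in> lin_rec_space T" unfolding span using that by (intro seq.span_base) blast
    \<comment> \<open>Apply \<pi> to the recurrence; the entries of \<open>c\<close> come from the
      base field and can be pulled out.\<close>
    then have "\<pi> (\<Sum>k\<le>degree T. coeff T k * to_ac (c (n + k))) = 0" for n
      by (simp add: lin_rec_space_def seq_ac_def \<pi>0)
    then have "(\<Sum>k\<le>degree T. \<pi> (coeff T k) * c (n + k)) = 0" for n
      unfolding \<pi>sum scale' .
    then show ?thesis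
      by (simp add: lin_rec_space_def deg) (simp add: R_def coeff_map_poly \<pi>0)
  qed
  have "seq.span (seq_ac ` W) \<subseteq> lin_rec_space (map_poly to_ac R)" using W_R
    by (intro seq.span_minimal lin_rec_space_subspace) (auto simp: seq_ac_mem_lin_rec_space)
  then have "T = map_poly to_ac R"
    unfolding span[symmetric] using T lead deg
    by (intro lin_rec_space_same_degree) (simp_all add: degree_map_poly coeff_map_poly)
  moreover have "lin_rec_space R = W"
  proof
    show "W \<subseteq> lin_rec_space R" using W_R by blast
    \<comment> \<open>Entrywise application of \<pi> maps the span back into \<open>W\<close> and
      undoes \<open>seq_ac\<close>.\<close>
    have retr: "(\<lambda>n. \<pi> (x n)) \<in> W" if "x \<in> seq.span (seq_ac ` W)" for x
      using that
    proof (induction rule: seq.span_induct_alt)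
      case base
      have "(\<lambda>n. \<pi> ((0 :: nat \<Rightarrow> 'a alg_closure) n)) = 0" by (simp add: fun_eq_iff \<pi>0)
      then show ?case using seq.subspace_0[OF W] by simp
    next
      case (step a x y)
      then obtain w where w: "w \<in> W" "x = seq_ac w" by blast
      have "(\<lambda>n. \<pi> ((seq_scale a x + y) n)) = seq_scale (\<pi> a) w + (\<lambda>n. \<pi> (y n))"
        using scale[of _ a] by (simp add: w fun_eq_iff seq_scale_def seq_ac_def add mult.commute)
      then show ?case
        using seq.subspace_add[OF W seq.subspace_scale[OF W w(1)] step.IH] by simp
    qed
    show "lin_rec_space R \<subseteq> W"
    proof
      fix c assume "c \<in> lin_rec_space R"
      then have "seq_ac c \<in> seq.span (seq_ac ` W)"
        unfolding span[symmetric] \<open>T = map_poly to_ac R\<close> by (simp add: seq_ac_mem_lin_rec_space)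
      from retr[OF this] show "c \<in> W" by (simp add: seq_ac_def retract)
    qed
  qed
  ultimately show thesis using that lead by blast
qed

section \<open>Descent of \<Upsilon> to the base field, joined with the nilpotent part\<close>

theorem theorem5p6:
  fixes m :: nat and P Q :: "nat \<Rightarrow> 'a::field poly" and s :: "nat \<Rightarrow> nat"
  assumes "m \<ge> 1"
    and "\<And>i. i \<in> {1..m} \<Longrightarrow> lead_coeff (P i) = 1"
    and "\<And>i. i \<in> {1..m} \<Longrightarrow> degree (P i) > 0"
    and "\<And>i. i \<in> {1..m} \<Longrightarrow> P i = monom 1 (s i) * Q i"
    and "\<And>i. i \<in> {1..m} \<Longrightarrow> poly (Q i) 0 \<noteq> 0"
  shows "let \<Theta> = {i \<in> {1..m}. Q i = 1};
             \<rho> = (if \<Theta> \<noteq> {} then Min (s ` \<Theta>) else Max (s ` {1..m}))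
         in iterated seq_space_prod m (\<lambda>i. lin_rec_space (P i)) =
              lin_rec_space (monom 1 \<rho> * upsilon m Q)"
proof -
  have lead: "lead_coeff (Q i) = 1" if "i \<in> {1..m}" for i
    using assms(2)[OF that] by (simp add: assms(4)[OF that] lead_coeff_mult degree_monom_eq)
  define W where "W = iterated seq_space_prod m (\<lambda>i. lin_rec_space (Q i))"
  have "lin_rec_space (upsilon_ac m Q) = iterated seq_space_prod m (\<lambda>i. lin_rec_space (map_poly to_ac (Q i)))"
    using iterated_prod_eq_upsilon_ac[OF assms(1) lead assms(5)] by simp
  also have "\<dots> = iterated seq_space_prod m (\<lambda>i. seq.span (seq_ac ` lin_rec_space (Q i)))"
    using assms(1) by (intro iterated_cong span_seq_ac_lin_rec_space lead)
  also have "\<dots> = seq.span (seq_ac ` W)"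
    unfolding W_def using assms(1) by (rule iterated_span_seq_ac)
  finally have span: "lin_rec_space (upsilon_ac m Q) = seq.span (seq_ac ` W)" .
  have "seq.subspace W"
  \<comment> \<open>For \<open>m = 1\<close> no product is formed, and \<open>W\<close> is itself a
    solution space.\<close>
  proof (cases "m = 1")
    case False
    then obtain l where "m = Suc l" "l \<ge> 1" using assms(1) by (cases m) auto
    then show ?thesis unfolding W_def by (simp add: iterated_Suc seq_space_prod_subspace)
  qed (simp add: W_def lin_rec_space_subspace)
  from lin_rec_space_descent[OF this monic_upsilon_ac span] obtain R where
    R: "map_poly to_ac R = upsilon_ac m Q" "lin_rec_space R = W" by metis
  have "upsilon m Q = R"
    unfolding upsilon_def
  proof (rule the_equality)
    fix R' :: "'a poly" assume "map_poly to_ac R' = upsilon_ac m Q"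
    then have "to_ac (coeff R' k) = to_ac (coeff R k)" for k
      using R(1) by (metis coeff_map_poly to_ac_0)
    then show "R' = R" by (simp add: poly_eq_iff)
  qed fact
  \<comment> \<open>All factors of \<Upsilon> have nonzero roots, so \<Upsilon> is coprime to powers
    of X and the solution space splits.\<close>
  moreover have "poly R 0 \<noteq> 0"
  proof -
    have "poly (upsilon_ac m Q) 0 \<noteq> 0"
      unfolding upsilon_ac_def poly_prod
      by (rule prod_nonzeroI) simp
    then show ?thesis unfolding R(1)[symmetric] by (simp add: poly_0_coeff_0 coeff_map_poly)
  qed
  ultimately have "lin_rec_space (monom 1 r * upsilon m Q) = seq.span (lin_rec_space (monom 1 r) \<union> W)" for r
    by (simp add: lin_rec_space_monom_mult R(2))
  then show ?thesis
    using iterated_prod_nilpotent_part[OF assms(1) lead assms(4,5)]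
    unfolding Let_def W_def by simp
qed

end
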